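(* Let $\mathcal{L}:M_n(\mathbb{C})\to[0,\infty)$ be a symmetric Lagrangian, let $b>0$, and let $\mathcal{S}(\alpha)=\int_0^b\mathcal{L}(\dot\alpha(t))\,dt$ be the associated action. Let $U\in\mathcal{U}(n)$ and $V=Ue^{iZ}$, where $Z$ is a Hermitian $n\times n$ matrix with $\|Z\|\le\pi$. Then the curve $\gamma:[0,b]\to\mathcal{U}(n)$, $\gamma(t)=Ue^{itZ/b}$, is optimal among piecewise smooth curves joining $U$ to $V$: for every piecewise smooth curve $\alpha:[0,b]\to\mathcal{U}(n)$ with $\alpha(0)=U$ and $\alpha(b)=V$ one has $\mathcal{S}(\gamma)\le\mathcal{S}(\alpha)$. In particular, the infimum of $\mathcal{S}$ over all such curves equals $b\,\mathcal{L}(Z/b)$.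
   Context: $M_n(\mathbb{C})$ is the algebra of complex $n\times n$ matrices, $\mathcal{U}(n)$ the group of unitary matrices, $\|\cdot\|$ the spectral (operator) norm. A symmetric Lagrangian is a convex function $\mathcal{L}:M_n(\mathbb{C})\to[0,\infty)$ with $\mathcal{L}(0)=0$ and $\mathcal{L}(UAV)=\mathcal{L}(A)$ for all $A\in M_n(\mathbb{C})$ and all $U,V\in\mathcal{U}(n)$. "Piecewise smooth" is used interchangeably with "piecewise $C^1$": $\alpha$ is continuous and there is a finite partition of $[0,b]$ such that $\alpha$ is $C^1$ on each closed subinterval. *)

theory Defs
  imports "HOL-Analysis.Analysis"
begin

text \<open>
  \<open>M\<^sub>n(\<complex>)\<close> is the type \<^typ>\<open>complex^'n^'n\<close>, whose library norm is the Frobenius norm; the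
  spectral norm is defined separately below. The operations \<open>*\<close> and \<open>^\<close> on this type are entrywise;
  matrix multiplication is \<open>**\<close>.
\<close>

definition cscale :: "complex \<Rightarrow> complex^'n^'m \<Rightarrow> complex^'n^'m"  (infixr "*\<^sub>C" 75) where
  "c *\<^sub>C A = map_matrix (\<lambda>z. c * z) A"

definition ctranspose :: "complex^'n^'m \<Rightarrow> complex^'m^'n" where
  "ctranspose A = map_matrix cnj (transpose A)"

definition hermitian :: "complex^'n^'n \<Rightarrow> bool" where
  "hermitian A \<longleftrightarrow> ctranspose A = A"

definition unitary :: "complex^'n^'n \<Rightarrow> bool" where
  "unitary A \<longleftrightarrow> ctranspose A ** A = mat 1 \<and> A ** ctranspose A = mat 1"

definition spectral_norm :: "complex^'n^'n \<Rightarrow> real" where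
  "spectral_norm A = onorm ((*v) A)"

primrec mpow :: "complex^'n^'n \<Rightarrow> nat \<Rightarrow> complex^'n^'n" where
  "mpow A 0 = mat 1"
| "mpow A (Suc k) = A ** mpow A k"

definition mexp :: "complex^'n^'n \<Rightarrow> complex^'n^'n" where
  "mexp A = (\<Sum>k. mpow A k /\<^sub>R fact k)"

definition symmetric_Lagrangian :: "(complex^'n^'n \<Rightarrow> real) \<Rightarrow> bool" where
  "symmetric_Lagrangian L \<longleftrightarrow>
     convex_on UNIV L \<and> (\<forall>A. 0 \<le> L A) \<and> L 0 = 0 \<and>
     (\<forall>A U V. unitary U \<longrightarrow> unitary V \<longrightarrow> L (U ** A ** V) = L A)"

text \<open>
  Derivatives at the endpoints of a closed interval are one-sided. The library's
  \<open>piecewise_C1_differentiable_on\<close> is weaker than \<open>piecewise_C1\<close>: it lets the derivative be unbounded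
  near a breakpoint.
\<close>

definition C1_on :: "(real \<Rightarrow> 'a::real_normed_vector) \<Rightarrow> real set \<Rightarrow> bool" where
  "C1_on f S \<longleftrightarrow>
     (\<exists>f'. (\<forall>t\<in>S. (f has_vector_derivative f' t) (at t within S)) \<and> continuous_on S f')"

definition piecewise_C1 :: "real \<Rightarrow> (real \<Rightarrow> 'a::real_normed_vector) \<Rightarrow> bool" where
  "piecewise_C1 b f \<longleftrightarrow>
     continuous_on {0..b} f \<and>
     (\<exists>(m::nat) p. p 0 = 0 \<and> p m = b \<and>
        (\<forall>i<m. p i < p (Suc i) \<and> C1_on f {p i..p (Suc i)}))"

definition curves_joining ::
    "real \<Rightarrow> complex^'n^'n \<Rightarrow> complex^'n^'n \<Rightarrow> (real \<Rightarrow> complex^'n^'n) set" where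
  "curves_joining b U V =
     {\<alpha>. piecewise_C1 b \<alpha> \<and> (\<forall>t\<in>{0..b}. unitary (\<alpha> t)) \<and> \<alpha> 0 = U \<and> \<alpha> b = V}"

text \<open>
  At the finitely many breakpoints of a piecewise \<open>C\<^sup>1\<close> curve \<^const>\<open>vector_derivative\<close> may be an
  unspecified matrix; these points do not affect the integral.
\<close>

definition action ::
    "(complex^'n^'n \<Rightarrow> real) \<Rightarrow> real \<Rightarrow> (real \<Rightarrow> complex^'n^'n) \<Rightarrow> real" where
  "action L b \<alpha> = integral {0..b} (\<lambda>t. L (vector_derivative \<alpha> (at t within {0..b})))"

end

theory Submission
  imports Defs
begin

text \<open>
  Let \<open>C\<close> be a subgradient of \<open>L\<close> at \<open>Z/b\<close> and let \<open>N A\<close> be the supremum of \<open>C \<bullet> PAQ\<close> over unitary \<open>P\<close>, \<open>Q\<close>.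
  Since \<open>L\<close> is unitarily invariant, \<open>N A \<le> L A + C \<bullet> Z/b - L (Z/b)\<close> for every \<open>A\<close>. Hence it is enough
  to show that the \<open>N\<close>-length of \<open>\<alpha>\<close> is at least \<open>C \<bullet> Z\<close>.

  To this end, put \<open>W = U\<^sup>* \<alpha>\<close>, with eigenvalues \<open>e\<^bsup>i\<theta>\<^esup>\<close>, and follow \<open>N\<close> of the diagonal matrix with entries
  \<open>arccos (r cos \<theta>)\<close>, where \<open>0 < r < 1\<close>. This smooths the angle \<open>\<bar>\<theta>\<bar>\<close> at the cut locus \<open>\<theta> = \<pi>\<close> and is still
  \<open>1\<close>-Lipschitz. Reading off the diagonal of a second unitary \<open>W'\<close> in an eigenbasis of \<open>W\<close> shows that
  this quantity grows by at most \<open>N (W' - W) + O(\<parallel>W' - W\<parallel>\<^sup>2)\<close>, so that its total growth along the curve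
  is bounded by the length. Finally \<open>r \<rightarrow> 1\<close>.
\<close>

section \<open>Matrices\<close>

lemma mult_component: "(A ** B) $ i $ j = (\<Sum>k\<in>UNIV. A $ i $ k * B $ k $ j)"
  by (simp add: matrix_matrix_mult_def)

lemma mat_component: "mat c $ i $ j = (if i = j then c else 0)"
  by (simp add: mat_def)

text \<open>A bilinear map between finite-dimensional spaces is bounded; the interpretation yields
  distributivity, continuity and the passage of derivatives and series through
  \<open>**\<close>.\<close>

interpretation mm: bounded_bilinear "(**) :: complex^'n^'m \<Rightarrow> complex^'p^'n \<Rightarrow> complex^'p^'m"
proof -
  have "bilinear ((**) :: complex^'n^'m \<Rightarrow> complex^'p^'n \<Rightarrow> complex^'p^'m)"
    unfolding bilinear_def
    by (auto intro!: linearI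
        simp: vec_eq_iff mult_component sum.distrib ring_distribs scaleR_right.sum)
  then show "bounded_bilinear ((**) :: complex^'n^'m \<Rightarrow> complex^'p^'n \<Rightarrow> complex^'p^'m)"
    by (simp add: bilinear_conv_bounded_bilinear)
qed

section \<open>Adjoints, unitary matrices and invariance of the Frobenius norm\<close>

lemma ctranspose_component [simp]: "ctranspose A $ i $ j = cnj (A $ j $ i)"
  by (simp add: ctranspose_def transpose_def)

lemma ctranspose_ctranspose [simp]: "ctranspose (ctranspose A) = A"
  by (simp add: vec_eq_iff)

lemma ctranspose_mult: "ctranspose (A ** B) = ctranspose B ** ctranspose A"
  by (simp add: vec_eq_iff mult_component mult.commute)

lemma ctranspose_mat [simp]: "ctranspose (mat c) = mat (cnj c)"
  by (simp add: vec_eq_iff mat_component)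

lemma unitary_ctranspose: "unitary A \<Longrightarrow> unitary (ctranspose A)"
  by (simp add: unitary_def)

lemma unitary_mat_1 [simp]: "unitary (mat 1)"
  by (simp add: unitary_def)

lemma unitary_cancel:
  assumes "unitary P"
  shows "ctranspose P ** (P ** A) = A" "P ** (ctranspose P ** A) = A"
    "A ** P ** ctranspose P = A" "A ** ctranspose P ** P = A"
proof -
  have P: "ctranspose P ** P = mat 1" "P ** ctranspose P = mat 1"
    using assms by (simp_all add: unitary_def)
  show "ctranspose P ** (P ** A) = A" "P ** (ctranspose P ** A) = A"
    by (simp_all only: matrix_mul_assoc P matrix_mul_lid)
  show "A ** P ** ctranspose P = A" "A ** ctranspose P ** P = A"
    by (simp_all only: P matrix_mul_rid flip: matrix_mul_assoc)
qed

lemma unitary_mult: "unitary A \<Longrightarrow> unitary B \<Longrightarrow> unitary (A ** B)"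
  unfolding unitary_def[of "A ** B"] ctranspose_mult
  by (simp add: matrix_mul_assoc unitary_cancel) (simp add: unitary_def)

text \<open>Expresses the real inner product by a trace, so that cyclicity of the trace and unitary
  cancellation apply to it.\<close>

lemma inner_matrix: "inner A B = Re (trace (ctranspose A ** B))"
  for A B :: "complex^'n^'m"
proof -
  have "inner A B = (\<Sum>i\<in>UNIV. \<Sum>j\<in>UNIV. Re (cnj (A $ i $ j) * B $ i $ j))"
    by (simp add: inner_vec_def inner_complex_def)
  also have "\<dots> = (\<Sum>j\<in>UNIV. \<Sum>i\<in>UNIV. Re (cnj (A $ i $ j) * B $ i $ j))"
    by (rule sum.swap)
  finally show ?thesis
    by (simp add: trace_def mult_component)
qed

lemma norm_unitary_left: "unitary P \<Longrightarrow> norm (P ** A) = norm A"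
  for A :: "complex^'n^'n"
  by (simp add: norm_eq_sqrt_inner inner_matrix ctranspose_mult unitary_cancel
      flip: matrix_mul_assoc)

lemma norm_unitary_right: "unitary P \<Longrightarrow> norm (A ** P) = norm A"
  for A :: "complex^'n^'n"
proof -
  assume P: "unitary P"
  have "trace (ctranspose (A ** P) ** (A ** P)) = trace ((ctranspose A ** (A ** P)) ** ctranspose P)"
    by (metis ctranspose_mult matrix_mul_assoc trace_mul_sym)
  also have "\<dots> = trace (ctranspose A ** A)"
    using P by (simp add: matrix_mul_assoc unitary_cancel)
  finally show ?thesis
    by (simp add: norm_eq_sqrt_inner inner_matrix)
qed

lemma norm_mat_1_unitary: "unitary P \<Longrightarrow> norm P = norm (mat 1 :: complex^'n^'n)"
  for P :: "complex^'n^'n"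
  by (metis matrix_mul_rid norm_unitary_left)

section \<open>Diagonal matrices\<close>

definition dg :: "('n \<Rightarrow> complex) \<Rightarrow> complex^'n^'n" where
  "dg d = (\<chi> i j. if i = j then d i else 0)"

lemma dg_component [simp]: "dg d $ i $ j = (if i = j then d i else 0)"
  by (simp add: dg_def)

lemma dg_mult_component [simp]: "(dg d ** A) $ i $ j = d i * A $ i $ j"
proof -
  have "(dg d ** A) $ i $ j = (\<Sum>k\<in>UNIV. if i = k then d k * A $ k $ j else 0)"
    unfolding mult_component by (intro sum.cong) auto
  then show ?thesis by simp
qed

lemma mult_dg_component [simp]: "(A ** dg d) $ i $ j = A $ i $ j * d j"
proof -
  have "(A ** dg d) $ i $ j = (\<Sum>k\<in>UNIV. if j = k then A $ i $ k * d k else 0)"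
    unfolding mult_component by (intro sum.cong) auto
  then show ?thesis by simp
qed

lemma dg_mult: "dg c ** dg d = dg (\<lambda>j. c j * d j)"
  by (simp add: vec_eq_iff)

lemma ctranspose_dg [simp]: "ctranspose (dg d) = dg (\<lambda>j. cnj (d j))"
  by (simp add: vec_eq_iff)

text \<open>Complex scalars act as \<open>mat c\<close>; reading \<open>mat c\<close> as a diagonal
  matrix opens them to the component rules for \<open>dg\<close>.\<close>

lemma dg_1: "dg (\<lambda>_. c) = mat c"
  by (simp add: vec_eq_iff mat_component)

lemma unitary_dg_iff: "unitary (dg d) \<longleftrightarrow> (\<forall>j. cmod (d j) = 1)"
proof -
  have "(cnj z * z = 1) = (cmod z = 1)" for z
  proof -
    have "cnj z * z = of_real ((cmod z)\<^sup>2)"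
      by (metis complex_norm_square mult.commute)
    then have "(cnj z * z = 1) = ((cmod z)\<^sup>2 = 1)"
      by (metis of_real_1 of_real_eq_iff)
    then show ?thesis
      using norm_ge_zero[of z] by (auto simp: power2_eq_1_iff)
  qed
  then show ?thesis
    by (auto simp: unitary_def dg_mult vec_eq_iff mat_component mult.commute)
qed

section \<open>The spectral theorem\<close>

text \<open>All unitary matrices have the Frobenius norm of the identity, and the conditions are
  closed. Compactness provides the maximiser used in the diagonalisation.\<close>

lemma compact_block_unitary:
  "compact {P :: complex^'n^'n. unitary P \<and> (\<forall>i j. P $ i $ j \<noteq> 0 \<longrightarrow> x i = x j)}"
    (is "compact ?S")
proof (rule compact_eq_bounded_closed[THEN iffD2], intro conjI)
  show "bounded ?S"
    by (auto simp: bounded_iff intro!: exI[of _ "norm (mat 1 :: complex^'n^'n)"]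
        dest: norm_mat_1_unitary)
  have ct: "continuous_on UNIV (ctranspose :: complex^'n^'n \<Rightarrow> _)"
    unfolding ctranspose_def map_matrix_def transpose_def by (intro continuous_intros)
  have "?S = {P. ctranspose P ** P = mat 1} \<inter> {P. P ** ctranspose P = mat 1}
     \<inter> (\<Inter>i. \<Inter>j. if x i = x j then UNIV else {P. P $ i $ j = 0})"
    unfolding unitary_def by auto
  moreover have "closed \<dots>"
    by (intro closed_Int closed_INT ballI closed_Collect_eq mm.continuous_on ct continuous_intros)
      (auto intro!: closed_Collect_eq continuous_intros)
  ultimately show "closed ?S" by simp
qed

text \<open>For a unit vector \<open>v\<close> this is the orthogonal projection onto the line
  spanned by \<open>v\<close>.\<close>

definition rank1 :: "('n \<Rightarrow> complex) \<Rightarrow> complex^'n^'n" where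
  "rank1 v = (\<chi> k l. v k * cnj (v l))"

lemma rank1_component [simp]: "rank1 v $ k $ l = v k * cnj (v l)"
  by (simp add: rank1_def)

lemma ctranspose_rank1 [simp]: "ctranspose (rank1 v) = rank1 v"
  by (simp add: vec_eq_iff mult.commute)

lemma rank1_idem:
  assumes "(\<Sum>k\<in>UNIV. v k * cnj (v k)) = 1"
  shows "rank1 v ** rank1 v = rank1 v"
proof -
  have "(\<Sum>k\<in>UNIV. v i * cnj (v k) * (v k * cnj (v j))) = v i * cnj (v j)" for i j
  proof -
    have "(\<Sum>k\<in>UNIV. v i * cnj (v k) * (v k * cnj (v j)))
        = (\<Sum>k\<in>UNIV. v k * cnj (v k)) * (v i * cnj (v j))"
      unfolding sum_distrib_right by (intro sum.cong) auto
    then show ?thesis using assms by simp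
  qed
  then show ?thesis by (simp add: vec_eq_iff mult_component)
qed

lemma mat_mult_commute: "A ** mat c = mat c ** A"
  for A :: "complex^'n^'n"
  by (simp flip: dg_1 add: vec_eq_iff)

lemma mat_mult_left_commute: "A ** (mat c ** B) = mat c ** (A ** B)"
  for A :: "complex^'n^'n"
  by (simp add: matrix_mul_assoc mat_mult_commute)

lemma mat_mult_mat: "mat a ** (mat b ** A) = mat (a * b) ** A"
  for A :: "complex^'n^'n"
  by (simp add: matrix_mul_assoc flip: dg_1 dg_mult)

lemma trace_mat_mult: "trace (mat u ** A) = u * trace A"
  for A :: "complex^'n^'n"
  by (simp add: trace_def sum_distrib_left flip: dg_1)

text \<open>The condition on \<open>z\<close> says that \<open>1 + z\<close> has modulus 1; the
  matrix multiplies the range of the projection \<open>p\<close> by \<open>1 + z\<close> and fixes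
  its kernel.\<close>

lemma unitary_projection_rotation:
  assumes p: "p ** p = p" "ctranspose p = p" and z: "z + cnj z + z * cnj z = 0"
  shows "unitary (mat 1 + mat z ** p)"
proof -
  have ct: "ctranspose (mat 1 + mat z ** p) = mat 1 + mat (cnj z) ** p"
    using p by (simp add: vec_eq_iff mat_component flip: dg_1)
  have e: "(mat 1 + mat u ** p) ** (mat 1 + mat w ** p) = mat 1" if "u + w + u * w = 0" for u w
  proof -
    have "(mat u ** p) ** (mat w ** p) = mat u ** mat w ** (p ** p)"
      by (metis mat_mult_commute matrix_mul_assoc)
    then have "(mat 1 + mat u ** p) ** (mat 1 + mat w ** p)
        = mat 1 + (mat u + mat w + mat u ** mat w) ** p"
      using p by (simp add: mm.add_left mm.add_right algebra_simps)
    also have "mat u + mat w + mat u ** mat w = mat 0"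
      using that by (simp add: vec_eq_iff mat_component flip: dg_1)
    finally show ?thesis by simp
  qed
  show ?thesis unfolding unitary_def ct using z by (auto intro!: e simp: algebra_simps)
qed

text \<open>Since \<open>v\<close> is supported on two coordinates, the trace sees only a 2 by 2
  block of \<open>B\<close>; this isolates an off-diagonal entry.\<close>

lemma trace_dg_rank1:
  fixes B :: "complex^'n^'n"
  assumes "i \<noteq> j" "v = (\<lambda>k. if k = i then a else if k = j then c else 0)"
  shows "trace (dg d ** B ** rank1 v) =
     d i * (B$i$i * a + B$i$j * c) * cnj a + d j * (B$j$i * a + B$j$j * c) * cnj c"
proof -
  have s: "(\<Sum>k\<in>UNIV. f k * v k) = f i * a + f j * c" for f :: "'n \<Rightarrow> complex"
  proof -
    have "(\<Sum>k\<in>UNIV. f k * v k) = (\<Sum>k\<in>{i,j}. f k * v k)"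
      by (rule sum.mono_neutral_right) (auto simp: assms)
    then show ?thesis using assms by simp
  qed
  have s': "(\<Sum>k\<in>UNIV. f k * cnj (v k)) = f i * cnj a + f j * cnj c" for f :: "'n \<Rightarrow> complex"
  proof -
    have "(\<Sum>k\<in>UNIV. f k * cnj (v k)) = (\<Sum>k\<in>{i,j}. f k * cnj (v k))"
      by (rule sum.mono_neutral_right) (auto simp: assms)
    then show ?thesis using assms by simp
  qed
  have "trace (dg d ** B ** rank1 v)
     = (\<Sum>k\<in>UNIV. (\<Sum>l\<in>UNIV. (d k * B$k$l) * v l) * cnj (v k))"
    by (simp add: trace_def mult_component[of "_ ** _"] sum_distrib_right mult.assoc)
  also have "\<dots> = d i * (B$i$i * a + B$i$j * c) * cnj a + d j * (B$j$i * a + B$j$j * c) * cnj c"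
    unfolding s s' by (simp add: algebra_simps)
  finally show ?thesis .
qed

text \<open>
  Maximise \<open>f P = Re (tr (D P\<^sup>* B P))\<close> with \<open>D\<close> diagonal with distinct real entries; perturbing a maximiser
  by \<open>1 + (e\<^bsup>is\<^esup> - 1) p\<close>, \<open>p\<close> a projection supported on two coordinates, shows that every
  off-diagonal entry of \<open>P\<^sup>* B P\<close> vanishes. The constraint that \<open>P\<close> is block diagonal for the
  partition given by \<open>x\<close> serves to diagonalise commuting matrices simultaneously.
\<close>
lemma block_hermitian_diagonalisation:
  fixes B :: "complex^'n^'n" and x :: "'n \<Rightarrow> 'a"
  assumes B: "hermitian B" and Bx: "\<And>i j. B $ i $ j \<noteq> 0 \<Longrightarrow> x i = x j"
  obtains P where "unitary P" "\<And>i j. P $ i $ j \<noteq> 0 \<Longrightarrow> x i = x j"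
    "\<And>i j. i \<noteq> j \<Longrightarrow> (ctranspose P ** B ** P) $ i $ j = 0"
proof -
  define block where "block P \<longleftrightarrow> (\<forall>i j. P $ i $ j \<noteq> 0 \<longrightarrow> x i = x j)" for P :: "complex^'n^'n"
  have block_mult: "block (P ** Q)" if "block P" "block Q" for P Q
    unfolding block_def
  proof (intro allI impI)
    fix i j assume "(P ** Q) $ i $ j \<noteq> 0"
    then obtain k where "P $ i $ k * Q $ k $ j \<noteq> 0"
      unfolding mult_component by (meson sum.neutral)
    then show "x i = x j" using that unfolding block_def by (metis mult_eq_0_iff)
  qed
  obtain a :: "'n \<Rightarrow> nat" where a: "inj a"
    using finite_imp_inj_to_nat_seg[of "UNIV :: 'n set"] by auto
  define D where "D = dg (\<lambda>j. of_nat (a j))"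
  define f where "f P = Re (trace (D ** (ctranspose P ** B ** P)))" for P
  let ?S = "{P :: complex^'n^'n. unitary P \<and> block P}"
  have cf: "continuous_on ?S f"
    unfolding f_def trace_def ctranspose_def map_matrix_def transpose_def
    by (intro continuous_intros mm.continuous_on)
  have "mat 1 \<in> ?S"
    by (auto simp: block_def mat_component split: if_splits)
  then obtain P where P: "unitary P" "block P" and max: "\<And>Q. unitary Q \<Longrightarrow> block Q \<Longrightarrow> f Q \<le> f P"
    using continuous_attains_sup[OF _ _ cf] compact_block_unitary[of x, folded block_def] by blast
  define C where "C = ctranspose P ** B ** P"
  have herm: "ctranspose C = C"
    using B unfolding C_def hermitian_def by (simp add: ctranspose_mult matrix_mul_assoc)
  have "block (ctranspose P)"
    using P(2) unfolding block_def ctranspose_component by (metis complex_cnj_zero)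
  then have Cb: "block C"
    unfolding C_def using P Bx by (intro block_mult) (auto simp: block_def)
  have crit: "Im (trace (D ** C ** p)) = 0" if p: "p ** p = p" "ctranspose p = p" "block p" for p
  proof -
    define \<tau> where "\<tau> = trace (D ** C ** p)"
    define c where "c = Re (trace (D ** (p ** C ** p)))"
    \<comment> \<open>\<open>g s\<close> is the expansion of \<open>f (P ** ?Q) - f P\<close>, where
      \<open>?Q\<close> rotates the range of \<open>p\<close> by the angle \<open>s\<close>. Its
      derivative at 0 is \<open>- 2 * Im \<tau>\<close>, which vanishes at a maximum.\<close>
    define g where "g s = - 2 * sin s * Im \<tau> + (2 - 2 * cos s) * (c - Re \<tau>)" for s
    have le: "g s \<le> g 0" for s
    proof -
      define z where "z = cis s - 1"
      have zr: "z + cnj z + z * cnj z = 0"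
        by (simp add: z_def algebra_simps cis_mult cis_cnj)
      let ?Q = "mat 1 + mat z ** p"
      have uQ: "unitary ?Q" using p zr by (intro unitary_projection_rotation)
      have "block ?Q" using p(3) unfolding block_def
        by (auto simp: mat_component simp flip: dg_1)
      then have le: "f (P ** ?Q) \<le> f P"
        by (intro max unitary_mult block_mult P uQ)
      have ct: "ctranspose ?Q = mat 1 + mat (cnj z) ** p"
        using p(2) by (simp add: vec_eq_iff mat_component flip: dg_1)
      have "D ** (ctranspose ?Q ** C ** ?Q) = D ** C + mat z ** (D ** C ** p)
          + mat (cnj z) ** (D ** p ** C) + mat (cnj z * z) ** (D ** (p ** C ** p))"
      proof -
        have 1: "mat (cnj z) ** p ** C ** (mat z ** p) = mat (cnj z * z) ** (p ** C ** p)"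
        proof -
          have "mat (cnj z) ** p ** C ** (mat z ** p) = mat (cnj z) ** (p ** C ** (mat z ** p))"
            by (simp only: matrix_mul_assoc)
          then show ?thesis
            by (simp only: mat_mult_left_commute[of "p ** C"] mat_mult_mat)
        qed
        have E: "ctranspose ?Q ** C ** ?Q = C + mat z ** (C ** p) + mat (cnj z) ** (p ** C)
             + mat (cnj z * z) ** (p ** C ** p)"
        proof -
          have "ctranspose ?Q ** C ** ?Q = C + C ** (mat z ** p) + mat (cnj z) ** p ** C
              + mat (cnj z) ** p ** C ** (mat z ** p)"
            unfolding ct
            by (simp only: mm.add_left mm.add_right matrix_mul_lid matrix_mul_rid add.assoc add.left_commute)
          then show ?thesis
            by (simp only: 1 mat_mult_left_commute[of C] matrix_mul_assoc[of "mat (cnj z)" p C])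
        qed
        show ?thesis
          unfolding E by (simp only: mm.add_right mat_mult_left_commute[of D]) (simp only: matrix_mul_assoc)
      qed
      moreover have "f (P ** ?Q) = Re (trace (D ** (ctranspose ?Q ** C ** ?Q)))"
        unfolding f_def C_def by (simp only: ctranspose_mult matrix_mul_assoc)
      ultimately have e1: "f (P ** ?Q) = Re (trace (D ** C)) + Re (z * \<tau>) + Re (cnj z * trace (D ** p ** C))
          + Re (cnj z * z * trace (D ** (p ** C ** p)))"
        by (simp only: trace_add trace_mat_mult plus_complex.simps \<tau>_def)
      have e2: "trace (D ** p ** C) = cnj \<tau>"
      proof -
        have Dc: "ctranspose D = D" by (simp add: D_def)
        have "cnj \<tau> = trace (ctranspose (D ** C ** p))" by (simp add: trace_def \<tau>_def)
        also have "\<dots> = trace ((p ** C) ** D)"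
          by (simp add: ctranspose_mult Dc herm p matrix_mul_assoc)
        finally show ?thesis by (metis trace_mul_sym matrix_mul_assoc)
      qed
      have e3: "Re (cnj z * cnj \<tau>) = Re (z * \<tau>)"
        by (metis cnj.simps(1) complex_cnj_mult)
      have e4: "cnj z * z = of_real (2 - 2 * cos s)"
        using zr by (simp add: z_def complex_eq_iff)
      have e5: "f P = Re (trace (D ** C))" by (simp add: f_def C_def)
      have "2 * Re (z * \<tau>) + (2 - 2 * cos s) * c \<le> 0"
        using le unfolding e1 e2 e3 e4 e5 c_def by (simp add: algebra_simps)
      moreover have "2 * Re (z * \<tau>) + (2 - 2 * cos s) * c = g s"
        by (simp add: g_def z_def algebra_simps)
      ultimately show ?thesis by (simp add: g_def)
    qed
    have "(g has_real_derivative - 2 * Im \<tau>) (at 0)"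
      unfolding g_def by (rule derivative_eq_intros refl | simp)+
    then have "- 2 * Im \<tau> = 0"
      by (rule DERIV_local_max[of _ _ _ 1]) (use le in simp_all)
    then show ?thesis by (simp add: \<tau>_def)
  qed
  have off: "C $ i $ j = 0" if ij: "i \<noteq> j" for i j
  proof (rule ccontr)
    assume nz: "C $ i $ j \<noteq> 0"
    \<comment> \<open>The phase \<open>u\<close> makes \<open>C $ i $ j * u\<close> equal to \<i>
      times a positive number, so that the projection onto the line of \<open>v\<close> detects the
      modulus of this entry in an imaginary part.\<close>
    define u where "u = \<i> * cnj (C $ i $ j) / of_real (cmod (C $ i $ j))"
    define r where "r = complex_of_real (1 / sqrt 2)"
    have rr: "r * r = 1/2" "cnj r = r"
      by (simp_all add: r_def flip: of_real_mult of_real_power)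
    have "cmod u = 1" using nz by (simp add: u_def norm_divide norm_mult)
    then have uu: "u * cnj u = 1" by (metis complex_norm_square of_real_1 one_power2)
    have Cu: "C $ i $ j * u = \<i> * of_real (cmod (C $ i $ j))"
    proof -
      have "C $ i $ j * u = \<i> * (C $ i $ j * cnj (C $ i $ j)) / of_real (cmod (C $ i $ j))"
        by (simp add: u_def)
      also have "C $ i $ j * cnj (C $ i $ j) = of_real (cmod (C $ i $ j)) * of_real (cmod (C $ i $ j))"
        by (simp only: complex_norm_square[symmetric] power2_eq_square of_real_mult)
      finally show ?thesis using nz by simp
    qed
    define v where "v = (\<lambda>k. if k = i then r else if k = j then r * u else 0)"
    have "(\<Sum>k\<in>UNIV. v k * cnj (v k)) = (\<Sum>k\<in>{i,j}. v k * cnj (v k))"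
      by (rule sum.mono_neutral_right) (auto simp: v_def)
    also have "\<dots> = r * r + r * r * (u * cnj u)"
      using ij rr by (simp add: v_def algebra_simps)
    finally have v1: "(\<Sum>k\<in>UNIV. v k * cnj (v k)) = 1" using rr uu by simp
    \<comment> \<open>A nonzero entry of \<open>C\<close> joins indices of one block, so the
      perturbation by \<open>rank1 v\<close> respects the blocks.\<close>
    have "x i = x j" using nz Cb by (auto simp: block_def)
    then have vx: "v k = 0 \<or> x k = x i" for k
      unfolding v_def by metis
    have "block (rank1 v)"
      unfolding block_def rank1_component by (metis vx complex_cnj_zero mult_zero_left mult_zero_right)
    from crit[OF rank1_idem[OF v1] ctranspose_rank1 this]
    have "Im (trace (D ** C ** rank1 v)) = 0" .
    also have "trace (D ** C ** rank1 v) =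
       r * r * (of_nat (a i) * (C$i$i + C$i$j * u) + of_nat (a j) * (C$j$i * cnj u + C$j$j * (u * cnj u)))"
      unfolding D_def trace_dg_rank1[OF ij v_def] complex_cnj_mult rr(2)
      by (simp add: algebra_simps)
    also have "C $ j $ i * cnj u = cnj (C $ i $ j * u)"
      by (metis complex_cnj_mult ctranspose_component herm)
    finally have "of_nat (a i) * (Im (C$i$i) + cmod (C$i$j))
        + of_nat (a j) * (Im (C$j$j) - cmod (C$i$j)) = (0::real)"
      unfolding rr uu Cu by simp
    moreover have "Im (C $ k $ k) = 0" for k
    proof -
      have "cnj (C $ k $ k) = C $ k $ k" by (metis ctranspose_component herm)
      then show ?thesis by (simp add: complex_eq_iff)
    qed
    \<comment> \<open>The two imaginary contributions have opposite signs; the distinct diagonal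
      entries of \<open>D\<close> keep them from cancelling.\<close>
    ultimately have "(real (a i) - real (a j)) * cmod (C$i$j) = 0"
      by (simp add: algebra_simps)
    with nz ij a show False by (simp add: inj_def)
  qed
  show ?thesis using that[OF P(1)] P(2) off unfolding block_def C_def by blast
qed

lemma diagonal_eq_dg: "(\<And>i j. i \<noteq> j \<Longrightarrow> A $ i $ j = 0) \<Longrightarrow> A = dg (\<lambda>j. A $ j $ j)"
  by (auto simp: vec_eq_iff)

lemma unconjugate: "unitary P \<Longrightarrow> ctranspose P ** A ** P = D \<Longrightarrow> A = P ** D ** ctranspose P"
  by (metis matrix_mul_assoc unitary_cancel(2,3))

lemma hermitian_diagonalisation:
  fixes B :: "complex^'n^'n"
  assumes "hermitian B"
  obtains P z where "unitary P" "B = P ** dg (\<lambda>j. of_real (z j)) ** ctranspose P"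
proof -
  \<comment> \<open>A constant labelling makes the block condition vacuous.\<close>
  obtain P where P: "unitary P" "\<And>i j. i \<noteq> j \<Longrightarrow> (ctranspose P ** B ** P) $ i $ j = 0"
    using block_hermitian_diagonalisation[OF assms, of "\<lambda>_. ()"] by auto
  define C where "C = ctranspose P ** B ** P"
  have "ctranspose C = C"
    using assms by (simp add: C_def hermitian_def ctranspose_mult matrix_mul_assoc)
  then have "C $ j $ j = of_real (Re (C $ j $ j))" for j
    by (metis Reals_cnj_iff ctranspose_component of_real_Re)
  then have "(\<lambda>j. C $ j $ j) = (\<lambda>j. of_real (Re (C $ j $ j)))"
    by (rule ext)
  moreover have "C = dg (\<lambda>j. C $ j $ j)"
    by (rule diagonal_eq_dg) (simp add: C_def P(2))
  ultimately have "C = dg (\<lambda>j. of_real (Re (C $ j $ j)))"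
    by metis
  then show ?thesis using unconjugate[OF P(1) C_def[symmetric]] that P(1) by metis
qed

text \<open>The Hermitian matrices \<open>W + ctranspose W\<close> and \<i> times
  \<open>W - ctranspose W\<close> commute. The first is diagonalised, then the second within the
  eigenspaces of the first.\<close>

lemma unitary_diagonalisation:
  fixes W :: "complex^'n^'n"
  assumes W: "unitary W"
  obtains P w where "unitary P" "\<And>j. cmod (w j) = 1" "W = P ** dg w ** ctranspose P"
proof -
  have "hermitian (W + ctranspose W)"
    by (simp add: hermitian_def vec_eq_iff add.commute)
  then obtain P x where P: "unitary P"
    and x: "W + ctranspose W = P ** dg (\<lambda>j. of_real (x j)) ** ctranspose P"
    by (rule hermitian_diagonalisation)
  define A where "A = ctranspose P ** W ** P"
  have uA: "unitary A"
    unfolding A_def by (intro unitary_mult unitary_ctranspose P W)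
  have "A + ctranspose A = ctranspose P ** (W + ctranspose W) ** P"
    by (simp add: A_def ctranspose_mult mm.add_left mm.add_right matrix_mul_assoc)
  also have "\<dots> = dg (\<lambda>j. of_real (x j))"
    unfolding x using P by (metis matrix_mul_assoc unitary_cancel(1,4))
  finally have Ax: "A + ctranspose A = dg (\<lambda>j. of_real (x j))" .
  \<comment> \<open>\<open>A\<close> commutes with its adjoint, hence with the diagonal matrix of
    the \<open>x j\<close>; comparing entries shows that \<open>A\<close> is block diagonal for the
    partition given by \<open>x\<close>.\<close>
  have "A ** (A + ctranspose A) = (A + ctranspose A) ** A"
    using uA by (simp add: unitary_def mm.add_left mm.add_right)
  then have "A $ i $ j * of_real (x j) = of_real (x i) * A $ i $ j" for i j
    unfolding Ax by (metis dg_mult_component mult_dg_component)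
  then have Ab: "A $ i $ j \<noteq> 0 \<Longrightarrow> x i = x j" for i j
    by (metis mult.commute mult_right_cancel of_real_eq_iff)
  define S where "S = mat \<i> ** (A - ctranspose A)"
  have Sc: "S $ i $ j = \<i> * (A $ i $ j - cnj (A $ j $ i))" for i j
    by (simp add: S_def flip: dg_1)
  have "hermitian S" by (simp add: hermitian_def vec_eq_iff Sc algebra_simps)
  moreover have "S $ i $ j \<noteq> 0 \<Longrightarrow> x i = x j" for i j
    unfolding Sc using Ab[of i j] Ab[of j i] by fastforce
  ultimately obtain Q where Q: "unitary Q" "\<And>i j. Q $ i $ j \<noteq> 0 \<Longrightarrow> x i = x j"
    "\<And>i j. i \<noteq> j \<Longrightarrow> (ctranspose Q ** S ** Q) $ i $ j = 0"
    using block_hermitian_diagonalisation[of S x] by blast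
  \<comment> \<open>Being block diagonal, \<open>Q\<close> commutes with the diagonal matrix of
    \<open>x\<close>, so the second diagonalisation preserves the first.\<close>
  have "dg (\<lambda>j. of_real (x j)) ** Q = Q ** dg (\<lambda>j. of_real (x j))"
    using Q(2) by (auto simp: vec_eq_iff)
  then have Qx: "ctranspose Q ** dg (\<lambda>j. of_real (x j)) ** Q = dg (\<lambda>j. of_real (x j))"
    using Q(1) by (metis matrix_mul_assoc unitary_cancel(1))
  have A2: "mat 2 ** A = dg (\<lambda>j. of_real (x j)) + mat (-\<i>) ** S"
    by (simp add: Ax[symmetric] vec_eq_iff Sc algebra_simps flip: dg_1 )
  define B where "B = ctranspose Q ** A ** Q"
  have "mat 2 ** B = ctranspose Q ** (mat 2 ** A) ** Q"
    unfolding B_def by (metis mat_mult_commute matrix_mul_assoc)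
  also have "\<dots> = dg (\<lambda>j. of_real (x j)) + mat (-\<i>) ** (ctranspose Q ** S ** Q)"
    unfolding A2 mm.add_left mm.add_right Qx by (metis mat_mult_commute matrix_mul_assoc)
  finally have "2 * B $ i $ j = (dg (\<lambda>j. of_real (x j)) $ i $ j)
      - \<i> * (ctranspose Q ** S ** Q) $ i $ j" for i j
    by (simp add: vec_eq_iff flip: dg_1)
  then have "B $ i $ j = 0" if "i \<noteq> j" for i j
    using that Q(3)[OF that] by (metis dg_component diff_zero mult_eq_0_iff mult_zero_right zero_neq_numeral)
  then have Bd: "B = dg (\<lambda>j. B $ j $ j)" by (rule diagonal_eq_dg)
  have "unitary B" unfolding B_def by (intro unitary_mult unitary_ctranspose Q uA)
  then have "cmod (B $ j $ j) = 1" for j using Bd by (metis unitary_dg_iff)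
  moreover have "ctranspose (P ** Q) ** W ** (P ** Q) = dg (\<lambda>j. B $ j $ j)"
    using Bd by (simp add: B_def A_def ctranspose_mult matrix_mul_assoc)
  ultimately show ?thesis
    by (intro that[OF unitary_mult[OF P Q(1)] _ unconjugate[OF unitary_mult[OF P Q(1)]]])
qed

section \<open>Unitarily invariant suprema\<close>

text \<open>This is \<open>N A\<close> for the given \<open>C\<close>. By von Neumann's trace
  inequality it is the sum of the products of the singular values of \<open>C\<close> and
  \<open>A\<close>, both in decreasing order.\<close>

definition orbit_sup :: "complex^'n^'n \<Rightarrow> complex^'n^'n \<Rightarrow> real" where
  "orbit_sup C A = (SUP PQ\<in>{P. unitary P} \<times> {Q. unitary Q}. inner C (fst PQ ** A ** snd PQ))"

text \<open>The supremum is finite by the Cauchy-Schwarz inequality and the unitary invariance of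
  the Frobenius norm.\<close>

lemma orbit_sup_upper:
  fixes C :: "complex^'n^'n"
  assumes "unitary P" "unitary Q"
  shows "inner C (P ** A ** Q) \<le> orbit_sup C A"
proof -
  have "inner C (P ** A ** Q) \<le> norm C * norm A" if "unitary P" "unitary Q" for P Q
    using norm_cauchy_schwarz[of C "P ** A ** Q"] that
    by (simp add: norm_unitary_left norm_unitary_right)
  then have "bdd_above ((\<lambda>PQ. inner C (fst PQ ** A ** snd PQ)) ` ({P. unitary P} \<times> {Q. unitary Q}))"
    by (intro bdd_aboveI[of _ "norm C * norm A"]) auto
  then show ?thesis
    unfolding orbit_sup_def by (rule cSUP_upper2[where x = "(P, Q)"]) (use assms in auto)
qed

lemma orbit_sup_least:
  assumes "\<And>P Q. unitary P \<Longrightarrow> unitary Q \<Longrightarrow> inner C (P ** A ** Q) \<le> m"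
  shows "orbit_sup C A \<le> m"
  unfolding orbit_sup_def
  by (rule cSUP_least) (use assms unitary_mat_1 in \<open>auto intro!: exI[of _ "mat 1"]\<close>)

lemma orbit_sup_unitary_le:
  assumes "unitary P" "unitary Q"
  shows "orbit_sup C (P ** A ** Q) \<le> orbit_sup C A"
proof (rule orbit_sup_least)
  fix R S :: "complex^'a^'a" assume "unitary R" "unitary S"
  then have "inner C ((R ** P) ** A ** (Q ** S)) \<le> orbit_sup C A"
    by (intro orbit_sup_upper unitary_mult assms)
  then show "inner C (R ** (P ** A ** Q) ** S) \<le> orbit_sup C A"
    by (simp only: matrix_mul_assoc)
qed

lemma orbit_sup_unitary:
  assumes "unitary P" "unitary Q"
  shows "orbit_sup C (P ** A ** Q) = orbit_sup C A"
proof (rule antisym)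
  have "ctranspose P ** (P ** A ** Q) ** ctranspose Q = A"
    using assms by (simp add: unitary_cancel matrix_mul_assoc) (simp add: unitary_def)
  then show "orbit_sup C A \<le> orbit_sup C (P ** A ** Q)"
    by (metis orbit_sup_unitary_le unitary_ctranspose assms)
qed (rule orbit_sup_unitary_le[OF assms])

lemma inner_conjugate:
  "inner C (P ** A ** Q) = Re (trace (Q ** ctranspose C ** P ** A))"
  for C :: "complex^'n^'n"
  unfolding inner_matrix by (metis matrix_mul_assoc trace_mul_sym)

section \<open>Sign averages and diagonal entries\<close>

definition set_sign :: "'n set \<Rightarrow> 'n \<Rightarrow> complex" where
  "set_sign S i = (if i \<in> S then 1 else -1)"

text \<open>Orthogonality of sign characters: for distinct \<open>i\<close> and \<open>j\<close>,
  toggling the membership of \<open>i\<close> in \<open>S\<close> is an involution that reverses the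
  sign of each term.\<close>

lemma sum_set_sign:
  fixes i j :: "'n::finite"
  shows "(\<Sum>S\<in>Pow UNIV. set_sign S i * set_sign S j) = (if i = j then 2 ^ CARD('n) else 0)"
proof (cases "i = j")
  case True
  then have "(\<Sum>S\<in>Pow UNIV. set_sign S i * set_sign S j) = (\<Sum>S\<in>Pow (UNIV::'n set). 1)"
    by (intro sum.cong) (auto simp: set_sign_def)
  then show ?thesis using True by (simp add: card_Pow)
next
  case False
  define T where "T S = (if i \<in> S then S - {i} else insert i S)" for S
  have "(\<Sum>S\<in>Pow UNIV. set_sign S i * set_sign S j) = (\<Sum>S\<in>Pow UNIV. - (set_sign S i * set_sign S j))"
    by (rule sum.reindex_bij_witness[of _ T T]) (use False in \<open>auto simp: T_def set_sign_def\<close>)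
  then show ?thesis using False by (simp add: sum_negf)
qed

text \<open>
  Averaging over the diagonal sign matrices kills the off-diagonal terms of the trace; a diagonal
  unitary aligns the phases of the remaining ones.
\<close>
lemma pinching:
  fixes C A :: "complex^'n^'n"
  assumes P: "unitary P" and Q: "unitary Q"
  defines "K \<equiv> Q ** ctranspose C ** P"
  shows "(\<Sum>j\<in>UNIV. cmod (K $ j $ j) * cmod (A $ j $ j)) \<le> orbit_sup C A"
proof -
  \<comment> \<open>The default 1 keeps the diagonal matrix of \<phi> unitary where the product
    vanishes and has no phase.\<close>
  define \<phi> where "\<phi> j = (let a = K $ j $ j * A $ j $ j in if a = 0 then 1 else cnj a / of_real (cmod a))" for j
  have n: "cmod (\<phi> j) = 1" for j by (simp add: \<phi>_def Let_def norm_divide norm_mult)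
  have \<phi>: "K $ j $ j * A $ j $ j * \<phi> j = of_real (cmod (K $ j $ j) * cmod (A $ j $ j))" for j
  proof (cases "K $ j $ j * A $ j $ j = 0")
    case False
    have "a * (cnj a / of_real (cmod a)) = of_real (cmod a)" if "a \<noteq> 0" for a
    proof -
      have "a * cnj a = of_real (cmod a) * of_real (cmod a)"
        by (simp only: complex_norm_square[symmetric] power2_eq_square of_real_mult)
      then show ?thesis using that by simp
    qed
    from this[OF False] False show ?thesis
      unfolding \<phi>_def Let_def by (simp add: norm_mult)
  qed auto
  have "(\<Sum>S\<in>Pow UNIV. inner C (P ** (dg (\<lambda>j. set_sign S j * \<phi> j) ** A ** dg (set_sign S)) ** Q))
      \<le> (\<Sum>S\<in>Pow (UNIV::'n set). orbit_sup C A)"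
  proof (rule sum_mono)
    fix S :: "'n set"
    have u: "unitary (dg (\<lambda>j. set_sign S j * \<phi> j))" "unitary (dg (set_sign S))"
      by (auto simp: unitary_dg_iff norm_mult n set_sign_def)
    show "inner C (P ** (dg (\<lambda>j. set_sign S j * \<phi> j) ** A ** dg (set_sign S)) ** Q) \<le> orbit_sup C A"
      using orbit_sup_upper[OF P Q] orbit_sup_unitary[OF u] by metis
  qed
  also have "\<dots> = 2 ^ CARD('n) * orbit_sup C A"
    by (simp add: card_Pow)
  also have "(\<Sum>S\<in>Pow UNIV. inner C (P ** (dg (\<lambda>j. set_sign S j * \<phi> j) ** A ** dg (set_sign S)) ** Q))
      = Re (\<Sum>S\<in>Pow UNIV. \<Sum>j\<in>UNIV. \<Sum>l\<in>UNIV. K $ j $ l * (\<phi> l * A $ l $ j) * (set_sign S l * set_sign S j))"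
    unfolding inner_conjugate K_def[symmetric] Re_sum trace_def
    by (intro sum.cong refl) (simp add: mult_component[of K] algebra_simps)
  also have "(\<Sum>S\<in>Pow UNIV. \<Sum>j\<in>UNIV. \<Sum>l\<in>UNIV. K $ j $ l * (\<phi> l * A $ l $ j) * (set_sign S l * set_sign S j))
      = (\<Sum>j\<in>UNIV. \<Sum>l\<in>UNIV. \<Sum>S\<in>Pow UNIV. K $ j $ l * (\<phi> l * A $ l $ j) * (set_sign S l * set_sign S j))"
    by (subst sum.swap) (intro sum.cong refl sum.swap)
  also have "\<dots> = (\<Sum>j\<in>UNIV. \<Sum>l\<in>UNIV. if l = j then K $ j $ l * (\<phi> l * A $ l $ j) * 2 ^ CARD('n) else 0)"
    by (intro sum.cong refl) (simp only: sum_set_sign flip: sum_distrib_left, simp)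
  also have "\<dots> = (\<Sum>j\<in>UNIV. of_real (2 ^ CARD('n) * (cmod (K $ j $ j) * cmod (A $ j $ j))))"
  proof (intro sum.cong refl)
    fix j
    have "K $ j $ j * (\<phi> j * A $ j $ j) = of_real (cmod (K $ j $ j) * cmod (A $ j $ j))"
      unfolding \<phi>[symmetric] by (simp only: ac_simps)
    then show "(\<Sum>l\<in>UNIV. if l = j then K $ j $ l * (\<phi> l * A $ l $ j) * 2 ^ CARD('n) else 0)
        = of_real (2 ^ CARD('n) * (cmod (K $ j $ j) * cmod (A $ j $ j)))"
      by simp
  qed
  also have "Re \<dots> = 2 ^ CARD('n) * (\<Sum>j\<in>UNIV. cmod (K $ j $ j) * cmod (A $ j $ j))"
    by (simp only: Re_sum Re_complex_of_real sum_distrib_left)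
  finally show ?thesis by simp
qed

text \<open>Converse to \<open>pinching\<close>: against a nonnegative diagonal matrix only the
  diagonal of \<open>Q ** ctranspose C ** P\<close> counts, so both estimates carry the same
  weights.\<close>

lemma inner_dg_le:
  fixes C :: "complex^'n^'n" and d :: "'n \<Rightarrow> real"
  assumes "\<And>j. 0 \<le> d j"
  shows "inner C (P ** dg (\<lambda>j. of_real (d j)) ** Q)
    \<le> (\<Sum>j\<in>UNIV. cmod ((Q ** ctranspose C ** P) $ j $ j) * d j)"
  unfolding inner_conjugate trace_def Re_sum
  by (intro sum_mono) (simp add: mult_right_mono assms complex_Re_le_cmod)

section \<open>Comparison of two unitary matrices\<close>

text \<open>With \<open>q\<close> the coefficient of the quadratic term,
  \<open>arccos (r * t) + q * t\<^sup>2\<close> has nonnegative second derivative on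
  \<open>{-1..1}\<close>, hence lies above its tangent at \<open>x\<close>.\<close>

lemma arccos_above_tangent:
  fixes r x y :: real
  assumes r: "0 < r" "r < 1" and x: "\<bar>x\<bar> \<le> 1" and y: "\<bar>y\<bar> \<le> 1"
  shows "arccos (r * x) - r / sqrt (1 - (r * x)\<^sup>2) * (y - x) - 1 / sqrt (1 - r\<^sup>2) ^ 3 * (y - x)\<^sup>2
    \<le> arccos (r * y)"
proof -
  define q where "q = 1 / sqrt (1 - r\<^sup>2) ^ 3"
  define s where "s t = sqrt (1 - (r * t)\<^sup>2)" for t
  have r2: "r\<^sup>2 < 1" using r by (simp add: power_less_one_iff)
  have le: "(r * t)\<^sup>2 \<le> r\<^sup>2" if "\<bar>t\<bar> \<le> 1" for t
    using that by (simp add: power_mult_distrib abs_square_le_1 mult_left_le)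
  have s0: "sqrt (1 - r\<^sup>2) \<le> s t" "0 < s t" if "\<bar>t\<bar> \<le> 1" for t
    using le[OF that] r2 by (auto simp: s_def)
  have rt: "-1 < r * t" "r * t < 1" if "\<bar>t\<bar> \<le> 1" for t
  proof -
    have "(r * t)\<^sup>2 < 1" using le[OF that] r2 by linarith
    then have "\<bar>r * t\<bar> < 1" by (simp only: abs_square_less_1)
    then show "-1 < r * t" "r * t < 1" by linarith+
  qed
  have s': "(s has_real_derivative - r\<^sup>2 * t / s t) (at t)" if "\<bar>t\<bar> \<le> 1" for t
    using s0[OF that] unfolding s_def
    by (auto intro!: derivative_eq_intros simp: divide_simps power2_eq_square)
  have "(- r / s x + 2 * q * x) * (y - x) \<le> (arccos (r * y) + q * y\<^sup>2) - (arccos (r * x) + q * x\<^sup>2)"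
  proof (rule f''_imp_f'[where C = "{-1..1}" and f'' = "\<lambda>t. - r * r\<^sup>2 * t / s t ^ 3 + 2 * q"])
    fix t :: real assume "t \<in> {-1..1}"
    then have t: "\<bar>t\<bar> \<le> 1" by auto
    show "((\<lambda>t. arccos (r * t) + q * t\<^sup>2) has_real_derivative - r / s t + 2 * q * t) (at t)"
      using rt[OF t] by (auto intro!: derivative_eq_intros simp: s_def divide_simps)
    show "((\<lambda>t. - r / s t + 2 * q * t) has_real_derivative - r * r\<^sup>2 * t / s t ^ 3 + 2 * q) (at t)"
    proof (rule DERIV_cong)
      show "((\<lambda>t. - r / s t + 2 * q * t) has_real_derivative
          (0 * s t - (- r) * (- r\<^sup>2 * t / s t)) / (s t * s t) + 2 * q) (at t)"
        using s0[OF t] by (intro DERIV_add DERIV_divide DERIV_const s'[OF t] DERIV_cmult_Id) auto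
    qed (use s0[OF t] in \<open>simp add: field_simps power3_eq_cube\<close>)
    have "r * r\<^sup>2 * t \<le> 1"
    proof -
      have "\<bar>r * r\<^sup>2 * t\<bar> \<le> 1" using r r2 t unfolding abs_mult by (intro mult_le_one) auto
      then show ?thesis by linarith
    qed
    then have "r * r\<^sup>2 * t / s t ^ 3 \<le> 1 / s t ^ 3"
      using s0[OF t] by (intro divide_right_mono) auto
    also have "\<dots> \<le> q"
      unfolding q_def using s0[OF t] r2 by (intro divide_left_mono power_mono) auto
    finally have "r * r\<^sup>2 * t / s t ^ 3 \<le> q" .
    moreover have "0 \<le> q" using r2 by (simp add: q_def)
    ultimately show "0 \<le> - r * r\<^sup>2 * t / s t ^ 3 + 2 * q" by simp
  qed (use x y in auto)
  then have "- r / s x * (y - x) + q * (2 * x * (y - x) - y\<^sup>2 + x\<^sup>2) \<le> arccos (r * y) - arccos (r * x)"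
    by (simp add: algebra_simps)
  moreover have "2 * x * (y - x) - y\<^sup>2 + x\<^sup>2 = - ((y - x)\<^sup>2)"
    by (simp add: power2_eq_square algebra_simps)
  ultimately have "- r / s x * (y - x) - q * (y - x)\<^sup>2 \<le> arccos (r * y) - arccos (r * x)"
    by simp
  then show ?thesis by (simp add: q_def s_def)
qed

lemma cmod_diff_unit_square:
  assumes "cmod a = 1" "cmod b = 1"
  shows "(cmod (a - b))\<^sup>2 = 2 - 2 * Re (cnj b * a)"
proof -
  have "(Re a)\<^sup>2 + (Im a)\<^sup>2 = 1" "(Re b)\<^sup>2 + (Im b)\<^sup>2 = 1"
    using assms by (simp_all flip: cmod_power2)
  then show ?thesis
    by (simp add: cmod_power2 power2_diff algebra_simps)
qed

text \<open>For unitary \<open>R\<close> the weights sum to 1, so a diagonal entry is a mean of the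
  eigenvalues.\<close>

lemma conjugate_dg_diagonal:
  "(R ** dg d ** ctranspose R) $ j $ j = (\<Sum>l\<in>UNIV. of_real ((cmod (R $ j $ l))\<^sup>2) * d l)"
  unfolding mult_component[of "_ ** _"] mult_dg_component
  by (intro sum.cong refl) (simp only: complex_norm_square ctranspose_component mult.assoc mult.left_commute mult.commute)

lemma row_norm_le: "(\<Sum>l\<in>UNIV. (cmod (A $ j $ l))\<^sup>2) \<le> (norm A)\<^sup>2"
  for A :: "complex^'n^'m"
proof -
  have "(\<Sum>l\<in>UNIV. (cmod (A $ j $ l))\<^sup>2) = (norm (A $ j))\<^sup>2"
    by (simp add: norm_vec_def L2_set_def sum_nonneg)
  also have "\<dots> \<le> (norm A)\<^sup>2"
    by (intro power_mono Finite_Cartesian_Product.norm_nth_le) auto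
  finally show ?thesis .
qed

text \<open>
  The point \<open>w\<close> of the circle is compared with a mean of points \<open>u l\<close> of the circle; \<open>e\<close> is the
  difference. By strict convexity of the disc the variance of the \<open>u l\<close> controls the component
  of \<open>e\<close> normal to the circle at \<open>w\<close>; tangentially, \<open>\<theta> \<mapsto> arccos (r cos \<theta>)\<close> is \<open>1\<close>-Lipschitz.
\<close>
lemma arccos_mean_ge:
  fixes p :: "'n::finite \<Rightarrow> real" and u :: "'n \<Rightarrow> complex"
  assumes r: "0 < r" "r < 1" and p: "\<And>l. 0 \<le> p l" "(\<Sum>l\<in>UNIV. p l) = 1"
    and w: "cmod w = 1" and u: "\<And>l. cmod (u l) = 1"
  defines "e \<equiv> (\<Sum>l\<in>UNIV. of_real (p l) * u l) - w"
    and "\<rho> \<equiv> (\<Sum>l\<in>UNIV. p l * (cmod (u l - w))\<^sup>2)"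
  shows "arccos (r * Re w) - cmod e - (1 / sqrt (1 - r\<^sup>2) + 1 / sqrt (1 - r\<^sup>2) ^ 3) * \<rho>
    \<le> (\<Sum>l\<in>UNIV. p l * arccos (r * Re (u l)))"
proof -
  define q where "q = 1 / sqrt (1 - r\<^sup>2) ^ 3"
  \<comment> \<open>\<open>- \<gamma>\<close> is the slope of \<open>arccos (r * x)\<close> at
    \<open>x = Re w\<close>.\<close>
  define \<gamma> where "\<gamma> = r / sqrt (1 - (r * Re w)\<^sup>2)"
  have r2: "r\<^sup>2 < 1" using r by (simp add: power_less_one_iff)
  have q0: "0 \<le> q" using r2 by (simp add: q_def)
  have rho0: "0 \<le> \<rho>" unfolding \<rho>_def by (intro sum_nonneg mult_nonneg_nonneg p) auto
  have re1: "\<bar>Re z\<bar> \<le> 1" if "cmod z = 1" for z using abs_Re_le_cmod[of z] that by simp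
  have e_mean: "e = (\<Sum>l\<in>UNIV. of_real (p l) * (u l - w))"
    using p(2) unfolding e_def
    by (simp add: right_diff_distrib sum_subtractf flip: sum_distrib_right of_real_sum)
  have Re_e: "Re e = (\<Sum>l\<in>UNIV. p l * (Re (u l) - Re w))"
    unfolding e_mean by simp
  have wr: "(Re w)\<^sup>2 + (Im w)\<^sup>2 = 1" using w by (simp flip: cmod_power2)
  have le: "(r * Re w)\<^sup>2 \<le> r\<^sup>2"
    using re1[OF w] by (simp add: power_mult_distrib abs_square_le_1 mult_left_le)
  then have pos: "0 < 1 - (r * Re w)\<^sup>2" using r2 by linarith
  have g0: "0 \<le> \<gamma>" using r pos by (simp add: \<gamma>_def)
  have "r / sqrt (1 - (r * Re w)\<^sup>2) \<le> 1 / sqrt (1 - r\<^sup>2)"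
    using r r2 le pos by (intro frac_le) auto
  then have g1: "\<gamma> \<le> 1 / sqrt (1 - r\<^sup>2)" by (simp add: \<gamma>_def)
  \<comment> \<open>The left side is the absolute value of the derivative of \<theta> \<mapsto>
    \<open>arccos (r * cos \<theta>)\<close> at the argument of \<open>w\<close>; this is the
    1-Lipschitz property.\<close>
  have g2: "\<gamma> * \<bar>Im w\<bar> \<le> 1"
  proof -
    have "(r * Im w)\<^sup>2 = r\<^sup>2 * (1 - (Re w)\<^sup>2)" using wr by (simp add: power_mult_distrib)
    also have "\<dots> \<le> 1 - (r * Re w)\<^sup>2" using r2 by (simp add: power_mult_distrib algebra_simps)
    finally have "\<bar>r * Im w\<bar> \<le> sqrt (1 - (r * Re w)\<^sup>2)"
      using real_le_rsqrt[of "\<bar>r * Im w\<bar>"] by simp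
    then show ?thesis using r pos by (simp add: \<gamma>_def abs_mult field_simps)
  qed
  have rho_e: "Re (cnj w * e) = - \<rho> / 2"
  proof -
    have "Re (cnj w * e) = (\<Sum>l\<in>UNIV. p l * Re (cnj w * (u l - w)))"
      unfolding e_mean sum_distrib_left Re_sum
      by (intro sum.cong refl) (simp add: algebra_simps)
    also have "\<dots> = (\<Sum>l\<in>UNIV. p l * (- (cmod (u l - w))\<^sup>2 / 2))"
    proof (intro sum.cong refl)
      fix l
      have "Re (cnj w * w) = 1" using wr by (simp add: power2_eq_square)
      then show "p l * Re (cnj w * (u l - w)) = p l * (- (cmod (u l - w))\<^sup>2 / 2)"
        unfolding cmod_diff_unit_square[OF u w] right_diff_distrib by simp
    qed
    also have "\<dots> = - \<rho> / 2"
      unfolding \<rho>_def by (simp add: sum_negf sum_divide_distrib)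
    finally show ?thesis .
  qed
  \<comment> \<open>In the frame rotated by \<open>w\<close>, the real part of
    \<open>cnj w * e\<close> is the normal component of \<open>e\<close>, known from
    \<open>rho_e\<close>, and the imaginary part is the tangential one.\<close>
  have "w * (cnj w * e) = e" using w by (simp flip: mult.assoc add: complex_norm_square[symmetric])
  then have "Re e = Re w * (- \<rho> / 2) - Im w * Im (cnj w * e)"
    by (metis times_complex.simps(1) rho_e)
  then have "\<gamma> * Re e = \<gamma> * (Re w * (- \<rho> / 2) - Im w * Im (cnj w * e))"
    by (simp only:)
  then have "\<gamma> * Re e = - (\<gamma> * Re w * \<rho> / 2) - \<gamma> * Im w * Im (cnj w * e)"
    by (simp add: right_diff_distrib)
  moreover have "\<bar>\<gamma> * Im w * Im (cnj w * e)\<bar> \<le> 1 * cmod e"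
  proof -
    have "\<bar>Im (cnj w * e)\<bar> \<le> cmod e"
      using abs_Im_le_cmod[of "cnj w * e"] w by (simp add: norm_mult)
    moreover have "\<bar>\<gamma> * Im w\<bar> \<le> 1" using g0 g2 by (simp add: abs_mult)
    ultimately show ?thesis unfolding abs_mult[of "\<gamma> * Im w"] by (intro mult_mono) auto
  qed
  moreover have "\<bar>\<gamma> * Re w * \<rho>\<bar> \<le> 1 / sqrt (1 - r\<^sup>2) * 1 * \<rho>"
    unfolding abs_mult using g0 g1 rho0 re1[OF w] r2 by (intro mult_mono) auto
  ultimately have lin: "\<gamma> * Re e \<le> cmod e + 1 / sqrt (1 - r\<^sup>2) * \<rho>"
    using rho0 by (simp add: abs_le_iff)
  have "arccos (r * Re w) - \<gamma> * Re e - q * (\<Sum>l\<in>UNIV. p l * (Re (u l) - Re w)\<^sup>2)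
     = (\<Sum>l\<in>UNIV. p l * (arccos (r * Re w) - \<gamma> * (Re (u l) - Re w) - q * (Re (u l) - Re w)\<^sup>2))"
    unfolding Re_e sum_distrib_left right_diff_distrib sum_subtractf
    using p(2) by (simp add: algebra_simps flip: sum_distrib_left sum_distrib_right)
  also have "\<dots> \<le> (\<Sum>l\<in>UNIV. p l * arccos (r * Re (u l)))"
    unfolding q_def \<gamma>_def
    by (intro sum_mono mult_left_mono p arccos_above_tangent r re1 w u)
  finally have 1: "arccos (r * Re w) - \<gamma> * Re e - q * (\<Sum>l\<in>UNIV. p l * (Re (u l) - Re w)\<^sup>2)
     \<le> (\<Sum>l\<in>UNIV. p l * arccos (r * Re (u l)))" .
  have "(\<Sum>l\<in>UNIV. p l * (Re (u l) - Re w)\<^sup>2) \<le> \<rho>"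
    unfolding \<rho>_def
    by (intro sum_mono mult_left_mono p) (simp add: cmod_power2)
  then have "q * (\<Sum>l\<in>UNIV. p l * (Re (u l) - Re w)\<^sup>2) \<le> q * \<rho>"
    using q0 by (rule mult_left_mono)
  with 1 lin show ?thesis
    unfolding q_def[symmetric] by (simp add: ring_distribs)
qed

text \<open>In an eigenbasis of \<open>W\<close>, each diagonal entry of \<open>W'\<close> is a mean
  of the \<open>w' l\<close>, and that of \<open>A\<close> is the corresponding mean of the
  arccosines. \<open>arccos_mean_ge\<close> compares them entrywise; \<open>inner_dg_le\<close> and
  \<open>pinching\<close> translate this into \<open>orbit_sup\<close>.\<close>

lemma orbit_sup_arccos_le:
  fixes C :: "complex^'n^'n"
  assumes r: "0 < r" "r < 1"
    and P: "unitary P" "unitary P'" and w: "\<And>j. cmod (w j) = 1" "\<And>j. cmod (w' j) = 1"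
    and W: "W = P ** dg w ** ctranspose P" "W' = P' ** dg w' ** ctranspose P'"
  shows "orbit_sup C (dg (\<lambda>j. of_real (arccos (r * Re (w j)))))
    \<le> orbit_sup C (dg (\<lambda>j. of_real (arccos (r * Re (w' j))))) + orbit_sup C (W' - W)
      + orbit_sup C (mat 1) * (1 / sqrt (1 - r\<^sup>2) + 1 / sqrt (1 - r\<^sup>2) ^ 3) * (norm (W' - W))\<^sup>2"
proof (rule orbit_sup_least)
  fix R S :: "complex^'n^'n" assume RS: "unitary R" "unitary S"
  define \<kappa> where "\<kappa> j = cmod ((S ** ctranspose C ** R) $ j $ j)" for j
  define c where "c = 1 / sqrt (1 - r\<^sup>2) + 1 / sqrt (1 - r\<^sup>2) ^ 3"
  have r2: "r\<^sup>2 < 1" using r by (simp add: power_less_one_iff)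
  have c0: "0 \<le> c" using r2 by (simp add: c_def)
  have k0: "0 \<le> \<kappa> j" for j by (simp add: \<kappa>_def)
  have pinch: "(\<Sum>j\<in>UNIV. \<kappa> j * cmod (A $ j $ j)) \<le> orbit_sup C A" for A
    unfolding \<kappa>_def by (rule pinching[OF RS])
  have ac: "0 \<le> arccos (r * Re z)" if "cmod z = 1" for z
  proof -
    have "\<bar>r * Re z\<bar> \<le> 1"
      using r abs_Re_le_cmod[of z] that unfolding abs_mult by (intro mult_le_one) auto
    then show ?thesis by (intro arccos_lbound) auto
  qed
  define T where "T = ctranspose P ** P'"
  have T: "unitary T" unfolding T_def by (intro unitary_mult unitary_ctranspose P)
  define p where "p j l = (cmod (T $ j $ l))\<^sup>2" for j l
  have p1: "(\<Sum>l\<in>UNIV. p j l) = 1" for j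
  proof -
    have "T ** dg (\<lambda>_. 1) ** ctranspose T = mat 1"
      using T by (simp add: dg_1 unitary_def)
    then have "(\<Sum>l\<in>UNIV. of_real (p j l) * 1 :: complex) = 1"
      unfolding p_def conjugate_dg_diagonal[symmetric] by (simp add: mat_component)
    then show ?thesis by (simp flip: of_real_sum)
  qed
  define E where "E = ctranspose P ** (W' - W) ** P"
  have E: "E = T ** dg w' ** ctranspose T - dg w"
  proof -
    have "ctranspose P ** W ** P = dg w"
      unfolding W using P(1) by (simp add: unitary_cancel flip: matrix_mul_assoc) (simp add: unitary_def)
    moreover have "ctranspose P ** W' ** P = T ** dg w' ** ctranspose T"
      unfolding W T_def by (simp add: ctranspose_mult matrix_mul_assoc)
    ultimately show ?thesis by (simp add: E_def mm.diff_left mm.diff_right)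
  qed
  have nE: "norm E = norm (W' - W)"
    unfolding E_def using P(1) by (simp add: norm_unitary_left norm_unitary_right unitary_ctranspose)
  have Ejj: "E $ j $ j = (\<Sum>l\<in>UNIV. of_real (p j l) * w' l) - w j" for j
    by (simp add: E conjugate_dg_diagonal p_def)
  define \<rho> where "\<rho> j = (\<Sum>l\<in>UNIV. p j l * (cmod (w' l - w j))\<^sup>2)" for j
  \<comment> \<open>\<open>\<rho> j\<close> is the squared norm of row \<open>j\<close> of
    \<open>E ** T\<close>, because \<open>T\<close> intertwines the two eigenbases.\<close>
  have rho: "\<rho> j \<le> (norm (W' - W))\<^sup>2" for j
  proof -
    have "E ** T = T ** dg w' - dg w ** T"
      unfolding E mm.diff_left using T by (simp add: unitary_cancel)
    then have "(E ** T) $ j $ l = (T ** dg w' - dg w ** T) $ j $ l" for l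
      by (simp only:)
    then have "(E ** T) $ j $ l = T $ j $ l * (w' l - w j)" for l
      by (simp add: algebra_simps)
    then have "\<rho> j = (\<Sum>l\<in>UNIV. (cmod ((E ** T) $ j $ l))\<^sup>2)"
      by (simp add: \<rho>_def p_def norm_mult power_mult_distrib)
    also have "\<dots> \<le> (norm (E ** T))\<^sup>2" by (rule row_norm_le)
    finally show ?thesis using T nE by (simp add: norm_unitary_right)
  qed
  define A where "A = T ** dg (\<lambda>j. of_real (arccos (r * Re (w' j)))) ** ctranspose T"
  have Ajj: "cmod (A $ j $ j) \<ge> arccos (r * Re (w j)) - cmod (E $ j $ j) - c * (norm (W' - W))\<^sup>2" for j
  proof -
    have "arccos (r * Re (w j)) - cmod (E $ j $ j) - c * \<rho> j
        \<le> (\<Sum>l\<in>UNIV. p j l * arccos (r * Re (w' l)))"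
      unfolding Ejj \<rho>_def c_def by (rule arccos_mean_ge) (use r p1 w in \<open>auto simp: p_def\<close>)
    also have "\<dots> = Re (A $ j $ j)"
      by (simp add: A_def conjugate_dg_diagonal p_def)
    also have "\<dots> \<le> cmod (A $ j $ j)" by (rule complex_Re_le_cmod)
    finally show ?thesis using mult_left_mono[OF rho[of j] c0] by linarith
  qed
  have "inner C (R ** dg (\<lambda>j. of_real (arccos (r * Re (w j)))) ** S)
      \<le> (\<Sum>j\<in>UNIV. \<kappa> j * arccos (r * Re (w j)))"
    unfolding \<kappa>_def by (rule inner_dg_le) (use ac w in auto)
  also have "\<dots> \<le> (\<Sum>j\<in>UNIV. \<kappa> j * (cmod (A $ j $ j) + cmod (E $ j $ j) + c * (norm (W' - W))\<^sup>2))"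
    using Ajj by (intro sum_mono mult_left_mono k0) (simp add: algebra_simps)
  \<comment> \<open>The quadratic error is written with the diagonal of \<open>mat 1\<close>, so
    that \<open>pinching\<close> bounds its weights too.\<close>
  also have "\<dots> = (\<Sum>j\<in>UNIV. \<kappa> j * cmod (A $ j $ j)) + (\<Sum>j\<in>UNIV. \<kappa> j * cmod (E $ j $ j))
      + (\<Sum>j\<in>UNIV. \<kappa> j * cmod (mat 1 $ j $ j)) * (c * (norm (W' - W))\<^sup>2)"
    by (simp add: sum.distrib ring_distribs sum_distrib_right mat_component)
  also have "\<dots> \<le> orbit_sup C A + orbit_sup C E + orbit_sup C (mat 1) * (c * (norm (W' - W))\<^sup>2)"
    by (intro add_mono pinch mult_right_mono) (use c0 in auto)
  also have "orbit_sup C A = orbit_sup C (dg (\<lambda>j. of_real (arccos (r * Re (w' j)))))"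
    unfolding A_def by (intro orbit_sup_unitary T unitary_ctranspose)
  also have "orbit_sup C E = orbit_sup C (W' - W)"
    unfolding E_def by (intro orbit_sup_unitary P unitary_ctranspose)
  finally show "inner C (R ** dg (\<lambda>j. of_real (arccos (r * Re (w j)))) ** S)
    \<le> orbit_sup C (dg (\<lambda>j. of_real (arccos (r * Re (w' j))))) + orbit_sup C (W' - W)
      + orbit_sup C (mat 1) * (1 / sqrt (1 - r\<^sup>2) + 1 / sqrt (1 - r\<^sup>2) ^ 3) * (norm (W' - W))\<^sup>2"
    unfolding c_def[symmetric] by (simp add: mult.assoc)
qed

section \<open>Convex functions and piecewise smooth curves\<close>

text \<open>The strict epigraph, translated so that the point over \<open>x0\<close> becomes the
  origin, is convex and omits 0; a separating hyperplane provides the slope.\<close>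

lemma convex_subgradient:
  fixes f :: "'a::euclidean_space \<Rightarrow> real"
  assumes f: "convex_on UNIV f"
  obtains c where "\<And>x. f x0 + inner c (x - x0) \<le> f x"
proof -
  define S where "S = {p :: 'a \<times> real. f (fst p + x0) - f x0 < snd p}"
  have "convex S"
  proof (rule convexI)
    fix p q :: "'a \<times> real" and u v :: real
    assume pq: "p \<in> S" "q \<in> S" and uv: "0 \<le> u" "0 \<le> v" "u + v = 1"
    have "fst (u *\<^sub>R p + v *\<^sub>R q) + x0 = u *\<^sub>R (fst p + x0) + v *\<^sub>R (fst q + x0)"
      using uv(3) by (simp add: algebra_simps flip: scaleR_left_distrib)
    then have "f (fst (u *\<^sub>R p + v *\<^sub>R q) + x0) \<le> u * f (fst p + x0) + v * f (fst q + x0)"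
      using f uv unfolding convex_on_def by simp
    moreover have "u * (f (fst p + x0) - f x0) + v * (f (fst q + x0) - f x0) < u * snd p + v * snd q"
    proof (cases "u = 0")
      case True
      then show ?thesis using pq uv by (simp add: S_def)
    next
      case False
      then show ?thesis
        using pq uv unfolding S_def
        by (intro add_less_le_mono mult_strict_left_mono mult_left_mono) auto
    qed
    moreover have "u * f x0 + v * f x0 = f x0"
      using uv(3) by (simp flip: distrib_right)
    ultimately show "u *\<^sub>R p + v *\<^sub>R q \<in> S"
      by (simp add: S_def right_diff_distrib)
  qed
  moreover have "0 \<notin> S" by (simp add: S_def)
  ultimately obtain a where a: "a \<noteq> 0" "\<And>p. p \<in> S \<Longrightarrow> 0 \<le> inner a p"
    using separating_hyperplane_set_0 by blast
  obtain g s where gs: "a = (g, s)" by (cases a)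
  have ge: "0 \<le> inner g x + s * y" if "f (x + x0) - f x0 < y" for x y
    using a(2)[of "(x, y)"] that by (simp add: S_def gs)
  have "0 \<le> s" using ge[of 0 1] by simp
  \<comment> \<open>The hyperplane is not vertical: \<open>f\<close> is finite everywhere, so a
    vertical one could be crossed in the direction \<open>- g\<close>.\<close>
  moreover have "s \<noteq> 0"
  proof
    assume "s = 0"
    then have "0 \<le> inner g (- g)"
      using ge[of "- g" "f (- g + x0) - f x0 + 1"] by simp
    then have "inner g g = 0"
      using inner_ge_zero[of g] unfolding inner_minus_right by linarith
    then have "g = 0" by (simp only: inner_eq_zero_iff)
    then show False using \<open>s = 0\<close> a(1) gs by (simp add: zero_prod_def)
  qed
  ultimately have s: "0 < s" by simp
  show ?thesis
  proof (rule that[of "(- 1 / s) *\<^sub>R g"])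
    fix x
    show "f x0 + inner ((- 1 / s) *\<^sub>R g) (x - x0) \<le> f x"
    proof (rule field_le_epsilon)
      \<comment> \<open>Points of the strict epigraph lie above the graph, whence the margin
        \<open>e\<close>.\<close>
      fix e :: real assume "0 < e"
      then have "0 \<le> inner g (x - x0) + s * (f x - f x0 + e)"
        using ge[of "x - x0" "f x - f x0 + e"] by simp
      then show "f x0 + inner ((- 1 / s) *\<^sub>R g) (x - x0) \<le> f x + e"
        using s by (simp add: field_simps)
    qed
  qed
qed

section \<open>Derivatives of piecewise smooth curves\<close>

text \<open>Off the breakpoints the derivative agrees with the continuous derivative of a closed
  piece, which is bounded by compactness. Integrability is obtained piece by piece, as endpoints do
  not matter.\<close>

lemma piecewise_C1_derivative:
  fixes f :: "real \<Rightarrow> 'a::euclidean_space"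
  assumes "piecewise_C1 b f"
  defines "d \<equiv> \<lambda>t. vector_derivative f (at t within {0..b})"
  obtains S B where "finite S" "0 \<le> B"
    "\<And>t. t \<in> {0..b} - S \<Longrightarrow> (f has_vector_derivative d t) (at t)"
    "\<And>t. t \<in> {0..b} - S \<Longrightarrow> norm (d t) \<le> B"
    "\<And>h :: 'a \<Rightarrow> real. continuous_on UNIV h \<Longrightarrow> (\<lambda>t. h (d t)) integrable_on {0..b}"
proof -
  obtain m :: nat and p where p0: "p 0 = 0" and pm: "p m = b"
    and p: "\<And>i. i < m \<Longrightarrow> p i < p (Suc i)" "\<And>i. i < m \<Longrightarrow> C1_on f {p i..p (Suc i)}"
    using assms unfolding piecewise_C1_def by blast
  obtain f' where f': "\<And>i t. i < m \<Longrightarrow> t \<in> {p i..p (Suc i)} \<Longrightarrow>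
      (f has_vector_derivative f' i t) (at t within {p i..p (Suc i)})"
    and cont: "\<And>i. i < m \<Longrightarrow> continuous_on {p i..p (Suc i)} (f' i)"
    using p(2) unfolding C1_on_def by metis
  have mono: "p i \<le> p j" if "i \<le> j" "j \<le> m" for i j
    using that by (induction j rule: dec_induct) (auto, meson Suc_le_eq less_imp_le order_trans p(1))
  \<comment> \<open>The inserted 0 covers \<open>k = 0\<close>, where the interval is a point and
    there are no pieces.\<close>
  have cover: "{0..p k} \<subseteq> insert 0 (\<Union>i<k. {p i..p (Suc i)})" if "k \<le> m" for k
    using that
  proof (induction k)
    case (Suc k)
    have "{0..p (Suc k)} \<subseteq> {0..p k} \<union> {p k..p (Suc k)}" by auto
    with Suc show ?case by (auto simp: lessThan_Suc)
  qed (auto simp: p0)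
  define S where "S = p ` {..m}"
  have piece: "(f has_vector_derivative f' i t) (at t) \<and> d t = f' i t"
    if i: "i < m" and t: "t \<in> {p i<..<p (Suc i)}" for i t
  proof -
    have "(f has_vector_derivative f' i t) (at t)"
      using f'[OF i, of t] t by (auto simp: at_within_Icc_at)
    moreover have "0 < t" "t < b"
      using mono[of 0 i] mono[of "Suc i" m] i t p0 pm by auto
    ultimately show ?thesis
      by (simp add: d_def at_within_Icc_at vector_derivative_at)
  qed
  have ex: "\<exists>i<m. t \<in> {p i<..<p (Suc i)}" if t: "t \<in> {0..b} - S" for t
  proof -
    have "t \<noteq> p i" if "i \<le> m" for i using t that by (auto simp: S_def)
    moreover from this[of 0] obtain i where i: "i < m" "t \<in> {p i..p (Suc i)}"
      using cover[of m] t p0 pm by auto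
    ultimately have "t \<noteq> p i" "t \<noteq> p (Suc i)" by auto
    with i show ?thesis by (intro exI[of _ i]) auto
  qed
  have "bounded (\<Union>i<m. f' i ` {p i..p (Suc i)})"
    by (intro bounded_UN finite_lessThan ballI compact_imp_bounded compact_continuous_image)
      (auto intro: cont)
  then obtain B where B: "\<And>i t. i < m \<Longrightarrow> t \<in> {p i..p (Suc i)} \<Longrightarrow> norm (f' i t) \<le> B"
    unfolding bounded_iff by fastforce
  show ?thesis
  proof (rule that[of S "\<bar>B\<bar>"])
    fix t assume "t \<in> {0..b} - S"
    with ex obtain i where i: "i < m" "t \<in> {p i<..<p (Suc i)}" by blast
    show "(f has_vector_derivative d t) (at t)"
      using piece[OF i] by simp
    show "norm (d t) \<le> \<bar>B\<bar>"
      using piece[OF i] B[OF i(1), of t] i(2) by auto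
  next
    fix h :: "'a \<Rightarrow> real" assume h: "continuous_on UNIV h"
    have "(\<lambda>t. h (d t)) integrable_on {0..p k}" if "k \<le> m" for k
      using that
    proof (induction k)
      case 0
      then show ?case
        using integrable_on_refl[of "\<lambda>t. h (d t)" "0::real"] by (simp add: p0)
    next
      case (Suc k)
      have "(\<lambda>t. h (f' k t)) integrable_on {p k..p (Suc k)}"
        using Suc by (intro integrable_continuous_real continuous_on_compose2[OF h] cont) auto
      then have "(\<lambda>t. h (d t)) integrable_on {p k..p (Suc k)}"
        by (rule integrable_spike_finite[of "{p k, p (Suc k)}", rotated 2])
          (use piece[of k] Suc in auto)
      moreover have "(\<lambda>t. h (d t)) integrable_on {0..p k}"
        using Suc by simp
      moreover have "0 \<le> p k" "p k \<le> p (Suc k)"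
        using mono[of 0 k] mono[of k "Suc k"] Suc.prems by (simp_all add: p0)
      ultimately show ?case
        by (metis Henstock_Kurzweil_Integration.integrable_combine)
    qed
    from this[of m] show "(\<lambda>t. h (d t)) integrable_on {0..b}" by (simp add: pm)
  qed (auto simp: S_def)
qed

text \<open>On \<open>n + 1\<close> equal subintervals the errors add up to
  \<open>c * b\<^sup>2 / (n + 1)\<close>, which tends to 0.\<close>

lemma decreasing_if_square_increments:
  fixes \<psi> :: "real \<Rightarrow> real"
  assumes b: "0 < b"
    and inc: "\<And>s t. 0 \<le> s \<Longrightarrow> s \<le> t \<Longrightarrow> t \<le> b \<Longrightarrow> \<psi> t - \<psi> s \<le> c * (t - s)\<^sup>2"
  shows "\<psi> b \<le> \<psi> 0"
proof -
  have le: "\<psi> b - \<psi> 0 \<le> c * b\<^sup>2 * (1 / real (Suc n))" for n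
  proof -
    define x where "x i = b * (real i / real (Suc n))" for i
    have "\<psi> (x (Suc n)) - \<psi> (x 0) = (\<Sum>i<Suc n. \<psi> (x (Suc i)) - \<psi> (x i))"
      by (rule sum_lessThan_telescope[symmetric])
    also have "\<dots> \<le> (\<Sum>i<Suc n. c * (b / real (Suc n))\<^sup>2)"
    proof (rule sum_mono)
      fix i assume "i \<in> {..<Suc n}"
      then have "x (Suc i) \<le> b" using b by (simp add: x_def field_simps)
      moreover have "0 \<le> x i" using b by (simp add: x_def)
      moreover have "x (Suc i) - x i = b / real (Suc n)"
        by (simp add: x_def add_divide_distrib distrib_left)
      moreover from this have "x i \<le> x (Suc i)"
        using b by (smt (verit) divide_pos_pos of_nat_0_less_iff zero_less_Suc)
      ultimately show "\<psi> (x (Suc i)) - \<psi> (x i) \<le> c * (b / real (Suc n))\<^sup>2"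
        using inc[of "x i" "x (Suc i)"] by simp
    qed
    also have "\<dots> = c * b\<^sup>2 * (1 / real (Suc n))"
      by (simp add: power2_eq_square field_simps del: of_nat_Suc)
    finally show ?thesis by (simp add: x_def)
  qed
  have "(\<lambda>n. c * b\<^sup>2 * (1 / real (Suc n))) \<longlonglongrightarrow> c * b\<^sup>2 * 0"
    by (intro tendsto_mult tendsto_const LIMSEQ_Suc[OF lim_1_over_n])
  then have "\<psi> b - \<psi> 0 \<le> c * b\<^sup>2 * 0"
    by (rule LIMSEQ_le_const) (use le in auto)
  then show ?thesis by simp
qed

section \<open>Exponentials of Hermitian matrices\<close>

lemma linear_dg_component: "bounded_linear (\<lambda>z. dg (\<lambda>k. if k = j then z else 0))"
  by (rule linear_conv_bounded_linear[THEN iffD1], rule linearI) (auto simp: vec_eq_iff)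

text \<open>Writes \<open>dg\<close> as a finite sum of linear functions of single entries, which
  reduces continuity, derivatives and series to the entries.\<close>

lemma dg_eq_sum: "dg d = (\<Sum>j\<in>UNIV. dg (\<lambda>k. if k = j then d j else 0))"
  by (auto simp: vec_eq_iff)

lemma continuous_on_dg:
  assumes "\<And>j. continuous_on S (\<lambda>t. d t j)"
  shows "continuous_on S (\<lambda>t. dg (d t))"
  by (subst dg_eq_sum)
    (intro continuous_on_sum bounded_linear.continuous_on[OF linear_dg_component] assms)

lemma has_vector_derivative_dg:
  assumes "\<And>j. ((\<lambda>t. d t j) has_vector_derivative d' j) F"
  shows "((\<lambda>t. dg (d t)) has_vector_derivative dg d') F"
  by (subst (1 2) dg_eq_sum)
    (intro has_vector_derivative_sum bounded_linear.has_vector_derivative[OF linear_dg_component] assms)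

lemma sums_dg:
  assumes "\<And>j. (\<lambda>n. d n j) sums s j"
  shows "(\<lambda>n. dg (d n)) sums dg s"
  by (subst (1 2) dg_eq_sum)
    (intro sums_sum bounded_linear.sums[OF linear_dg_component] assms)

lemma mpow_conjugate_dg:
  assumes "unitary Q"
  shows "mpow (Q ** dg d ** ctranspose Q) k = Q ** dg (\<lambda>j. d j ^ k) ** ctranspose Q"
proof (induction k)
  case 0
  then show ?case using assms by (simp add: dg_1 unitary_def)
next
  case (Suc k)
  have "mpow (Q ** dg d ** ctranspose Q) (Suc k)
      = (Q ** dg d ** ctranspose Q) ** (Q ** dg (\<lambda>j. d j ^ k) ** ctranspose Q)"
    by (simp add: Suc)
  also have "\<dots> = Q ** (dg d ** dg (\<lambda>j. d j ^ k)) ** ctranspose Q"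
    using assms by (simp add: matrix_mul_assoc unitary_cancel)
  finally show ?case by (simp add: dg_mult)
qed

lemma mexp_conjugate_dg:
  assumes "unitary Q"
  shows "mexp (Q ** dg d ** ctranspose Q) = Q ** dg (\<lambda>j. exp (d j)) ** ctranspose Q"
proof -
  have "(\<lambda>k. dg (\<lambda>j. d j ^ k /\<^sub>R fact k)) sums dg (\<lambda>j. exp (d j))"
    by (intro sums_dg exp_converges)
  then have "(\<lambda>k. Q ** dg (\<lambda>j. d j ^ k /\<^sub>R fact k) ** ctranspose Q)
      sums (Q ** dg (\<lambda>j. exp (d j)) ** ctranspose Q)"
    by (intro bounded_linear.sums[OF mm.bounded_linear_left] bounded_linear.sums[OF mm.bounded_linear_right])
  moreover have "dg (\<lambda>j. d j ^ k /\<^sub>R fact k) = dg (\<lambda>j. d j ^ k) /\<^sub>R fact k" for k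
    by (simp add: vec_eq_iff)
  ultimately show ?thesis
    unfolding mexp_def mpow_conjugate_dg[OF assms]
    by (simp add: mm.scaleR_left mm.scaleR_right sums_iff)
qed

lemma cscale_conjugate_dg:
  fixes Q :: "complex^'n^'n"
  shows
  "c *\<^sub>C (Q ** dg d ** ctranspose Q) = Q ** dg (\<lambda>j. c * d j) ** ctranspose Q"
proof -
  have "c *\<^sub>C A = mat c ** A" for A :: "complex^'n^'n"
    by (simp add: cscale_def vec_eq_iff flip: dg_1)
  moreover have "mat c ** (Q ** dg d ** ctranspose Q) = Q ** (mat c ** dg d) ** ctranspose Q"
    by (simp only: mat_mult_commute[of Q, symmetric] matrix_mul_assoc)
  ultimately show ?thesis by (simp add: dg_mult flip: dg_1)
qed

lemma mult_axis_component: "(A *v axis j 1) $ i = A $ i $ j"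
  for A :: "complex^'n^'m"
proof -
  have "(A *v axis j 1) $ i = (\<Sum>k\<in>UNIV. if j = k then A $ i $ k else 0)"
    unfolding matrix_vector_mult_def vec_lambda_beta
    by (rule sum.cong) (auto simp: axis_def)
  then show ?thesis by simp
qed

text \<open>Column \<open>j\<close> of \<open>Q\<close> is an eigenvector of \<open>Z\<close> with
  eigenvalue \<open>d j\<close>.\<close>

lemma eigenvalue_le_spectral_norm:
  fixes Q :: "complex^'n^'n"
  assumes Q: "unitary Q" and Z: "Z = Q ** dg d ** ctranspose Q"
  shows "cmod (d j) \<le> spectral_norm Z"
proof -
  define v where "v = Q *v axis j 1"
  have "Z *v v = (Z ** Q) *v axis j 1" by (simp add: v_def matrix_vector_mul_assoc)
  also have "Z ** Q = Q ** dg d" unfolding Z using Q by (simp add: unitary_cancel)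
  also have "(Q ** dg d) *v axis j 1 = d j *s v"
    by (simp add: v_def vec_eq_iff mult_axis_component mult.commute)
  finally have "norm (d j *s v) \<le> spectral_norm Z * norm v"
    unfolding spectral_norm_def using onorm[OF matrix_vector_mul_bounded_linear[of Z], of v] by simp
  moreover have "norm (d j *s v) = cmod (d j) * norm v"
    by (simp add: norm_vec_def L2_set_def norm_mult power_mult_distrib real_sqrt_mult flip: sum_distrib_left)
  moreover have "v \<noteq> 0"
  proof
    assume "v = 0"
    then have "ctranspose Q *v v = 0" by simp
    moreover have "ctranspose Q *v v = axis j 1"
      using Q by (simp add: v_def matrix_vector_mul_assoc unitary_def)
    ultimately show False by simp
  qed
  ultimately show ?thesis by simp
qed

section \<open>The lower bound for the action\<close>

lemma symmetric_Lagrangian_continuous: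
  "symmetric_Lagrangian L \<Longrightarrow> continuous_on UNIV L"
  unfolding symmetric_Lagrangian_def by (intro convex_on_continuous) auto

lemma symmetric_Lagrangian_unitary:
  assumes "symmetric_Lagrangian L"
  shows "unitary P \<Longrightarrow> L (P ** A) = L A" "unitary P \<Longrightarrow> L (A ** P) = L A"
proof -
  have "unitary P \<Longrightarrow> unitary Q \<Longrightarrow> L (P ** A ** Q) = L A" for P Q
    using assms by (simp add: symmetric_Lagrangian_def)
  from this[of P "mat 1"] this[of "mat 1" P]
  show "unitary P \<Longrightarrow> L (P ** A) = L A" "unitary P \<Longrightarrow> L (A ** P) = L A"
    by simp_all
qed

text \<open>The matrix -1 is unitary.\<close>

lemma orbit_sup_minus: "orbit_sup C (- A) = orbit_sup C A"
proof -
  have "- A = dg (\<lambda>_. -1) ** A ** mat 1"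
    by (simp add: vec_eq_iff)
  then show ?thesis
    using orbit_sup_unitary[of "dg (\<lambda>_. -1)" "mat 1" C A] by (simp add: unitary_dg_iff)
qed

lemma orbit_sup_mat_le:
  assumes "0 \<le> x"
  shows "orbit_sup C (mat (of_real x)) \<le> x * orbit_sup C (mat 1)"
proof (rule orbit_sup_least)
  fix P Q :: "complex^'a^'a" assume PQ: "unitary P" "unitary Q"
  have "mat (of_real x) = x *\<^sub>R (mat 1 :: complex^'a^'a)"
    by (simp add: vec_eq_iff mat_component scaleR_conv_of_real[where 'a = complex])
  then have "inner C (P ** mat (of_real x) ** Q) = x * inner C (P ** mat 1 ** Q)"
    by (simp add: mm.scaleR_left mm.scaleR_right)
  also have "\<dots> \<le> x * orbit_sup C (mat 1)"
    using PQ assms by (intro mult_left_mono orbit_sup_upper)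
  finally show "inner C (P ** mat (of_real x) ** Q) \<le> x * orbit_sup C (mat 1)" .
qed

lemma orbit_sup_0_le: "orbit_sup C 0 \<le> 0"
  by (rule orbit_sup_least) simp

lemma action_lower_bound:
  fixes L :: "complex^'n^'n \<Rightarrow> real"
  assumes L: "symmetric_Lagrangian L" and b: "0 < b" and U: "unitary U"
    and Z: "hermitian Z" "spectral_norm Z \<le> pi"
    and \<alpha>: "\<alpha> \<in> curves_joining b U (U ** mexp (\<i> *\<^sub>C Z))"
  shows "b * L (Z /\<^sub>R b) \<le> action L b \<alpha>"
proof -
  obtain Q z where Q: "unitary Q" and Zd: "Z = Q ** dg (\<lambda>j. of_real (z j)) ** ctranspose Q"
    using Z(1) by (rule hermitian_diagonalisation)
  have z: "\<bar>z j\<bar> \<le> pi" for j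
    using eigenvalue_le_spectral_norm[OF Q Zd, of j] Z(2) by simp
  have expZ: "mexp (\<i> *\<^sub>C Z) = Q ** dg (\<lambda>j. cis (z j)) ** ctranspose Q"
    unfolding Zd cscale_conjugate_dg mexp_conjugate_dg[OF Q] cis_conv_exp ..
  obtain C where C: "\<And>A. L (Z /\<^sub>R b) + inner C (A - Z /\<^sub>R b) \<le> L A"
    using L unfolding symmetric_Lagrangian_def by (metis convex_subgradient)
  \<comment> \<open>With this constant the subgradient inequality becomes
    \<open>inner C A \<le> L A + k\<close>, and \<open>b * k\<close> is
    \<open>inner C Z - b * L (Z /\<^sub>R b)\<close>.\<close>
  define k where "k = inner C Z / b - L (Z /\<^sub>R b)"
  have C: "inner C A \<le> L A + k" for A
    using C[of A] by (simp add: k_def inner_diff_right divide_inverse mult.commute)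
  have pc: "piecewise_C1 b \<alpha>" and uni: "\<And>t. t \<in> {0..b} \<Longrightarrow> unitary (\<alpha> t)"
    and \<alpha>0: "\<alpha> 0 = U" and \<alpha>b: "\<alpha> b = U ** mexp (\<i> *\<^sub>C Z)"
    using \<alpha> by (auto simp: curves_joining_def)
  define d where "d t = vector_derivative \<alpha> (at t within {0..b})" for t
  obtain S B where S: "finite S" and B: "0 \<le> B"
    and der: "\<And>t. t \<in> {0..b} - S \<Longrightarrow> (\<alpha> has_vector_derivative d t) (at t)"
    and bound: "\<And>t. t \<in> {0..b} - S \<Longrightarrow> norm (d t) \<le> B"
    and int: "\<And>h. continuous_on UNIV h \<Longrightarrow> (\<lambda>t. h (d t) :: real) integrable_on {0..b}"
    using piecewise_C1_derivative[OF pc] unfolding d_def by metis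
  define g where "g t = L (d t) + k" for t
  have gint: "g integrable_on {0..b}"
    unfolding g_def
    by (intro int[of "\<lambda>A. L A + k"] continuous_intros symmetric_Lagrangian_continuous L)
  define J where "J t = integral {0..t} g" for t
  have ftc: "(d has_integral \<alpha> t - \<alpha> s) {s..t}" if "0 \<le> s" "s \<le> t" "t \<le> b" for s t
  proof (rule fundamental_theorem_of_calculus_interior_strong[OF S])
    show "continuous_on {s..t} \<alpha>"
      using pc that unfolding piecewise_C1_def by (auto elim: continuous_on_subset)
  qed (use der that in auto)
  have lip: "norm (\<alpha> t - \<alpha> s) \<le> B * (t - s)" if "0 \<le> s" "s \<le> t" "t \<le> b" for s t
    using has_integral_bound_spike_finite[OF B S, of d "\<alpha> t - \<alpha> s" s t] ftc[OF that] bound that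
    by auto
  \<comment> \<open>For fixed unitary factors the functional is linear and passes under the
    integral, where the subgradient inequality and the invariance of \<open>L\<close> bound it by
    \<open>g\<close>.\<close>
  have N: "orbit_sup C (\<alpha> t - \<alpha> s) \<le> J t - J s" if st: "0 \<le> s" "s \<le> t" "t \<le> b" for s t
  proof -
    have g: "g integrable_on {s..t}" "g integrable_on {0..t}"
      using st by (auto intro!: integrable_subinterval_real[OF gint])
    have "J t - J s = integral {s..t} g"
      using Henstock_Kurzweil_Integration.integral_combine[of 0 s t g] st g unfolding J_def by simp
    moreover have "orbit_sup C (\<alpha> t - \<alpha> s) \<le> integral {s..t} g"
    proof (rule orbit_sup_least)
      fix P R :: "complex^'n^'n" assume PR: "unitary P" "unitary R"
      have "bounded_linear (\<lambda>A. inner C (P ** A ** R))"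
        by (intro bounded_linear_compose[OF bounded_linear_inner_right]
            bounded_linear_compose[OF mm.bounded_linear_left] mm.bounded_linear_right)
      from has_integral_linear[OF ftc[OF st] this]
      have "((\<lambda>x. inner C (P ** d x ** R)) has_integral inner C (P ** (\<alpha> t - \<alpha> s) ** R)) {s..t}"
        by (simp add: o_def)
      then show "inner C (P ** (\<alpha> t - \<alpha> s) ** R) \<le> integral {s..t} g"
      proof (rule has_integral_le[OF _ integrable_integral[OF g(1)]])
        fix x
        show "inner C (P ** d x ** R) \<le> g x"
          using C[of "P ** d x ** R"] PR
          by (simp add: g_def symmetric_Lagrangian_unitary[OF L])
      qed
    qed
    ultimately show ?thesis by simp
  qed
  define W where "W t = ctranspose U ** \<alpha> t" for t
  \<comment> \<open>The diagonalisations are chosen separately for each \<open>t\<close>;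
    \<open>orbit_sup_arccos_le\<close> compares any two of them.\<close>
  have "\<exists>P w. t \<in> {0..b} \<longrightarrow> unitary P \<and> (\<forall>j. cmod (w j) = 1) \<and> W t = P ** dg w ** ctranspose P" for t
  proof (cases "t \<in> {0..b}")
    case True
    then have "unitary (W t)"
      unfolding W_def by (intro unitary_mult unitary_ctranspose U uni)
    then show ?thesis by (rule unitary_diagonalisation) blast
  qed auto
  then obtain P w where Pw: "\<And>t. t \<in> {0..b} \<Longrightarrow> unitary (P t)"
    "\<And>t j. t \<in> {0..b} \<Longrightarrow> cmod (w t j) = 1"
    "\<And>t. t \<in> {0..b} \<Longrightarrow> W t = P t ** dg (w t) ** ctranspose (P t)"
    by metis
  \<comment> \<open>The arccosine recovers only the modulus of \<open>z j\<close>; the sign is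
    absorbed into a unitary factor.\<close>
  define \<sigma> :: "'n \<Rightarrow> real" where "\<sigma> j = (if z j < 0 then -1 else 1)" for j
  have key: "inner C (Q ** dg (\<lambda>j. of_real (\<sigma> j * arccos (r * cos (z j)))) ** ctranspose Q)
      - arccos r * orbit_sup C (mat 1) \<le> J b" if r: "0 < r" "r < 1" for r
  proof -
    define F where "F t = orbit_sup C (dg (\<lambda>j. of_real (arccos (r * Re (w t j)))))" for t
    define c where "c = orbit_sup C (mat 1) * (1 / sqrt (1 - r\<^sup>2) + 1 / sqrt (1 - r\<^sup>2) ^ 3)"
    \<comment> \<open>The growth of \<open>F\<close> exceeds that of \<open>J\<close> by at most a
      quadratic term, since \<alpha> is Lipschitz with constant \<open>B\<close>.\<close>
    have "F b - J b \<le> F 0 - J 0"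
    proof (rule decreasing_if_square_increments[OF b])
      fix s t assume st: "0 \<le> s" "s \<le> t" "t \<le> b"
      then have st': "s \<in> {0..b}" "t \<in> {0..b}" by auto
      have Wd: "W s - W t = - (ctranspose U ** (\<alpha> t - \<alpha> s))"
        by (simp add: W_def mm.diff_right)
      have "F t \<le> F s + orbit_sup C (W s - W t) + c * (norm (W s - W t))\<^sup>2"
        unfolding F_def c_def using st'
        by (intro orbit_sup_arccos_le[OF r Pw(1) Pw(1) _ _ Pw(3) Pw(3)] Pw(2))
      also have "orbit_sup C (W s - W t) = orbit_sup C (\<alpha> t - \<alpha> s)"
        using orbit_sup_unitary[OF unitary_ctranspose[OF U] unitary_mat_1, of C "\<alpha> t - \<alpha> s"]
        by (simp add: Wd orbit_sup_minus)
      also have "norm (W s - W t) = norm (\<alpha> t - \<alpha> s)"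
        by (simp add: Wd norm_unitary_left unitary_ctranspose U)
      also have "c * (norm (\<alpha> t - \<alpha> s))\<^sup>2 \<le> \<bar>c\<bar> * (B * (t - s))\<^sup>2"
        by (intro mult_mono power_mono lip st) auto
      finally show "F t - J t - (F s - J s) \<le> \<bar>c\<bar> * B\<^sup>2 * (t - s)\<^sup>2"
        using N[OF st] by (simp add: power_mult_distrib)
    qed
    moreover have "J 0 = 0" by (simp add: J_def)
    moreover have "F 0 \<le> arccos r * orbit_sup C (mat 1)"
    proof -
      have 0: "0 \<in> {0..b}" using b by simp
      have "W 0 = mat 1" using U by (simp add: W_def \<alpha>0 unitary_def)
      \<comment> \<open>Comparing two diagonalisations of the same matrix leaves no error term. The
        regularised angle at the eigenvalue 1 is \<open>arccos r\<close>, which tends to 0 as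
        \<open>r\<close> tends to 1.\<close>
      then have "F 0 \<le> orbit_sup C (dg (\<lambda>j. of_real (arccos (r * Re 1)))) + orbit_sup C (mat 1 - mat 1)
          + c * (norm (mat 1 - mat 1 :: complex^'n^'n))\<^sup>2"
        unfolding F_def c_def
        by (intro orbit_sup_arccos_le[OF r Pw(1)[OF 0] unitary_mat_1 Pw(2)[OF 0] _ ])
          (use Pw(3)[OF 0] in \<open>simp_all add: dg_1\<close>)
      also have "\<dots> \<le> orbit_sup C (mat (of_real (arccos r)))"
        using orbit_sup_0_le[of C] by (simp add: dg_1)
      also have "\<dots> \<le> arccos r * orbit_sup C (mat 1)"
        using r by (intro orbit_sup_mat_le arccos_lbound) auto
      finally show ?thesis .
    qed
    moreover have "inner C (Q ** dg (\<lambda>j. of_real (\<sigma> j * arccos (r * cos (z j)))) ** ctranspose Q) \<le> F b"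
    proof -
      have bb: "b \<in> {0..b}" using b by simp
      have "unitary (Q ** dg (\<lambda>j. of_real (\<sigma> j)))"
        by (intro unitary_mult Q) (auto simp: unitary_dg_iff \<sigma>_def)
      then have "inner C ((Q ** dg (\<lambda>j. of_real (\<sigma> j)))
          ** dg (\<lambda>j. of_real (arccos (r * Re (cis (z j))))) ** ctranspose Q)
        \<le> orbit_sup C (dg (\<lambda>j. of_real (arccos (r * Re (cis (z j))))))"
        by (intro orbit_sup_upper unitary_ctranspose Q)
      also have "(Q ** dg (\<lambda>j. of_real (\<sigma> j)))
          ** dg (\<lambda>j. of_real (arccos (r * Re (cis (z j))))) ** ctranspose Q
        = Q ** dg (\<lambda>j. of_real (\<sigma> j * arccos (r * cos (z j)))) ** ctranspose Q"
        by (simp add: dg_mult flip: matrix_mul_assoc[of Q])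
      also have "orbit_sup C (dg (\<lambda>j. of_real (arccos (r * Re (cis (z j)))))) \<le>
          F b + orbit_sup C (W b - W b) + c * (norm (W b - W b))\<^sup>2"
        unfolding F_def c_def
        by (intro orbit_sup_arccos_le[OF r Q Pw(1)[OF bb] _ Pw(2)[OF bb] _ Pw(3)[OF bb]])
          (use U in \<open>simp_all add: W_def \<alpha>b expZ unitary_cancel\<close>)
      also have "\<dots> \<le> F b" using orbit_sup_0_le[of C] by simp
      finally show ?thesis .
    qed
    ultimately show ?thesis by linarith
  qed
  define f where "f r = inner C (Q ** dg (\<lambda>j. of_real (\<sigma> j * arccos (r * cos (z j)))) ** ctranspose Q)
      - arccos r * orbit_sup C (mat 1)" for r
  have range: "- 1 \<le> r * cos x \<and> r * cos x \<le> 1" if "r \<in> {0..1}" for r x :: real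
  proof -
    have "\<bar>r * cos x\<bar> \<le> 1"
      unfolding abs_mult using that by (intro mult_le_one) auto
    then show ?thesis by linarith
  qed
  \<comment> \<open>The passage to \<open>r = 1\<close>, by continuity of the arccosine on
    \<open>{-1..1}\<close>.\<close>
  have "f 1 \<le> J b"
  proof (rule continuous_le_on_closure[of "{0<..<1}" f])
    show "continuous_on (closure {0<..<1}) f"
      unfolding f_def using range
      by (intro continuous_intros continuous_on_dg mm.continuous_on) auto
    show "f r \<le> J b" if "r \<in> {0<..<1}" for r
      using key[of r] that by (simp add: f_def)
  qed auto
  \<comment> \<open>Here the bound \<pi> on the spectral norm enters: it makes
    \<open>arccos (cos (z j))\<close> equal to the modulus of \<open>z j\<close>.\<close>
  moreover have "\<sigma> j * arccos (1 * cos (z j)) = z j" for j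
    using z[of j] arccos_cos2[of "z j"] by (auto simp: \<sigma>_def arccos_cos)
  then have "f 1 = inner C Z"
    by (simp add: f_def Zd)
  moreover have "J b = action L b \<alpha> + b * k"
  proof -
    have "(\<lambda>t. L (d t)) integrable_on {0..b}"
      by (intro int symmetric_Lagrangian_continuous L)
    moreover have "g = (\<lambda>t. L (d t) + k)"
      by (rule ext) (rule g_def)
    ultimately show ?thesis
      using b by (simp add: J_def Henstock_Kurzweil_Integration.integral_add integrable_const_ivl action_def d_def mult.commute)
  qed
  moreover have "b * k = inner C Z - b * L (Z /\<^sub>R b)"
    using b by (simp add: k_def right_diff_distrib)
  ultimately show ?thesis by linarith
qed

section \<open>The curve \<gamma>, its action and the infimum\<close>

theorem theorem3p4:
  fixes L :: "complex^'n^'n \<Rightarrow> real"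
    and U V Z :: "complex^'n^'n"
    and \<gamma> :: "real \<Rightarrow> complex^'n^'n"
    and b :: real
  assumes "symmetric_Lagrangian L"
    and "b > 0"
    and "unitary U"
    and "hermitian Z"
    and "spectral_norm Z \<le> pi"
    and "V = U ** mexp (\<i> *\<^sub>C Z)"
    and "\<gamma> = (\<lambda>t. U ** mexp ((\<i> * of_real (t / b)) *\<^sub>C Z))"
  shows "\<gamma> \<in> curves_joining b U V
    \<and> (\<forall>\<alpha>\<in>curves_joining b U V. action L b \<gamma> \<le> action L b \<alpha>)
    \<and> (INF \<alpha>\<in>curves_joining b U V. action L b \<alpha>) = b * L (Z /\<^sub>R b)"
proof -
  obtain Q z where Q: "unitary Q" and Zd: "Z = Q ** dg (\<lambda>j. of_real (z j)) ** ctranspose Q"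
    using assms(4) by (rule hermitian_diagonalisation)
  define E where "E t = Q ** dg (\<lambda>j. cis (t / b * z j)) ** ctranspose Q" for t
  have \<gamma>: "\<gamma> t = U ** E t" for t
    unfolding assms(7) Zd cscale_conjugate_dg mexp_conjugate_dg[OF Q] E_def
    by (simp add: cis_conv_exp mult.assoc)
  have uE: "unitary (E t)" for t
    unfolding E_def by (intro unitary_mult unitary_ctranspose Q) (simp add: unitary_dg_iff)
  define E' where "E' t = Q ** dg (\<lambda>j. (z j / b) *\<^sub>R (\<i> * cis (t / b * z j))) ** ctranspose Q" for t
  \<comment> \<open>The velocity is \<open>Z /\<^sub>R b\<close> times unitary factors, \<i> among
    them as a diagonal matrix; hence \<open>L\<close> is constant along \<gamma>.\<close>
  have E'_eq: "E' t = E t ** (dg (\<lambda>_. \<i>) ** (Z /\<^sub>R b))" for t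
  proof -
    have "Z /\<^sub>R b = Q ** dg (\<lambda>j. of_real (z j / b)) ** ctranspose Q"
    proof -
      have "dg (\<lambda>j. of_real (z j / b)) = dg (\<lambda>j. of_real (z j)) /\<^sub>R b"
        by (simp add: vec_eq_iff scaleR_conv_of_real[where 'a = complex] divide_inverse mult.commute)
      then show ?thesis by (simp add: Zd mm.scaleR_left mm.scaleR_right)
    qed
    moreover have "dg (\<lambda>_. \<i>) ** (Q ** D ** ctranspose Q) = Q ** (dg (\<lambda>_. \<i>) ** D) ** ctranspose Q" for D
      unfolding dg_1 by (simp only: mat_mult_commute[of Q, symmetric] matrix_mul_assoc)
    ultimately have "E t ** (dg (\<lambda>_. \<i>) ** (Z /\<^sub>R b))
        = Q ** (dg (\<lambda>j. cis (t / b * z j)) ** (dg (\<lambda>_. \<i>) ** dg (\<lambda>j. of_real (z j / b)))) ** ctranspose Q"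
      using Q by (simp add: E_def matrix_mul_assoc unitary_cancel)
    then show ?thesis
      by (simp add: E'_def dg_mult scaleR_conv_of_real[where 'a = complex] ac_simps)
  qed
  have derE: "(E has_vector_derivative E' t) (at t within T)" for t T
  proof -
    have "((\<lambda>t. cis (t / b * z j)) has_vector_derivative (z j / b) *\<^sub>R (\<i> * cis (t / b * z j))) (at t within T)" for j
    proof -
      define c where "c = \<i> * complex_of_real (z j / b)"
      have "((\<lambda>w. exp (w * c)) has_field_derivative exp (of_real t * c) * c) (at (of_real t))"
        by (auto intro!: derivative_eq_intros)
      then have "((\<lambda>t. exp (of_real t * c)) has_vector_derivative exp (of_real t * c) * c) (at t within T)"
        by (rule has_vector_derivative_real_field)
      moreover have "exp (of_real s * c) = cis (s / b * z j)" for s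
        by (simp add: c_def cis_conv_exp ac_simps)
      ultimately show ?thesis
        by (simp add: c_def scaleR_conv_of_real[where 'a = complex] ac_simps)
    qed
    then show ?thesis
      unfolding E_def E'_def
      by (intro bounded_linear.has_vector_derivative[OF mm.bounded_linear_left]
          bounded_linear.has_vector_derivative[OF mm.bounded_linear_right] has_vector_derivative_dg)
  qed
  have der: "(\<gamma> has_vector_derivative U ** E' t) (at t within T)" for t T
    unfolding \<gamma> by (intro bounded_linear.has_vector_derivative[OF mm.bounded_linear_right] derE)
  have cont: "continuous_on T (\<lambda>t. U ** E' t)" for T
    unfolding E'_def using assms(2)
    by (intro mm.continuous_on continuous_on_dg continuous_intros) auto
  have "piecewise_C1 b \<gamma>"
    unfolding piecewise_C1_def
  \<comment> \<open>A single smooth piece, with breakpoints 0 and \<open>b\<close>.\<close>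
  proof (intro conjI exI[of _ "1::nat"] exI[of _ "\<lambda>i. real i * b"])
    show "continuous_on {0..b} \<gamma>"
      by (rule continuous_on_vector_derivative) (rule der)
    show "real 0 * b = 0" "real 1 * b = b" by simp_all
    show "\<forall>i<1. real i * b < real (Suc i) * b \<and> C1_on \<gamma> {real i * b..real (Suc i) * b}"
      using assms(2) der cont by (auto simp: C1_on_def intro!: exI[of _ "\<lambda>t. U ** E' t"])
  qed
  moreover have "\<gamma> 0 = U"
    using Q by (simp add: \<gamma> E_def dg_1 unitary_def)
  moreover have "\<gamma> b = V"
    using assms(2) by (simp add: assms(6,7))
  ultimately have mem: "\<gamma> \<in> curves_joining b U V"
    by (simp add: curves_joining_def \<gamma> unitary_mult assms(3) uE)
  have "action L b \<gamma> = integral {0..b} (\<lambda>t. L (Z /\<^sub>R b))"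
    unfolding action_def
  proof (rule integral_cong)
    fix t assume "t \<in> {0..b}"
    then have "vector_derivative \<gamma> (at t within {0..b}) = U ** E' t"
      using assms(2) der by (intro vector_derivative_at_within_ivl[of _ _ _ 0 b]) auto
    then show "L (vector_derivative \<gamma> (at t within {0..b})) = L (Z /\<^sub>R b)"
      using symmetric_Lagrangian_unitary(1)[OF assms(1)] assms(3) uE
      by (simp add: E'_eq unitary_dg_iff)
  qed
  then have act: "action L b \<gamma> = b * L (Z /\<^sub>R b)"
    using assms(2) by simp
  have low: "action L b \<gamma> \<le> action L b \<alpha>" if "\<alpha> \<in> curves_joining b U V" for \<alpha>
    using action_lower_bound[OF assms(1-5)] that unfolding act assms(6) by blast
  have "(INF \<alpha>\<in>curves_joining b U V. action L b \<alpha>) = action L b \<gamma>"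
    using mem low by (intro cInf_eq_minimum) auto
  with mem low act show ?thesis by simp
qed

end
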